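(* Let $B=(B_t)_{t\ge 0}$ be a standard one-dimensional Brownian motion started at $0$ and let $T_1=\inf\{t\ge 0: B_t=1\}$. For $m\ge 0$ (real) let $$I_+^{(m)}=\mathbb{E}\Big[\frac{1}{T_1^{1+m/2}}\int_0^{T_1}(B_s^+)^m\,ds\Big],\qquad I_-^{(m)}=\mathbb{E}\Big[\frac{1}{T_1^{1+m/2}}\int_0^{T_1}(B_s^-)^m\,ds\Big],$$ and $$\phi(m)=\int_0^2\frac{y^{m+1}}{1+y}\,dy .$$ Then for every $m\ge 0$, $$I_+^{(m)}=\frac{c_m}{2^{m+1}}\,\phi(m),\qquad I_-^{(m)}=\frac{c_m}{2^{m+1}}\,\log(3).$$
   Context: $x^+=\max(x,0)$ and $x^-=\max(-x,0)$, with the convention $0^0=0$. For $m\ge 0$, $$c_m=\frac{\Gamma(1+m)}{2^{m/2}\Gamma(1+m/2)}=\frac{1}{\sqrt{\pi}}2^{m/2}\Gamma\Big(\frac{1+m}{2}\Big)=\mathbb{E}[|N|^m],$$ where $N$ is a standard Gaussian random variable and $\Gamma$ is the Gamma function. *)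

theory Defs
  imports "HOL-Probability.Probability"
begin

text \<open>
  Time is the half-line \<^term>\<open>{0::real..}\<close>; the values of \<open>B\<close> at negative times are irrelevant.
  The starting point and the continuity of paths are required almost surely only.
\<close>

locale standard_brownian_motion = prob_space M for M :: "'a measure" +
  fixes B :: "real \<Rightarrow> 'a \<Rightarrow> real"
  assumes measurable_B: "\<And>t. 0 \<le> t \<Longrightarrow> B t \<in> borel_measurable M"
    and start_zero: "AE \<omega> in M. B 0 \<omega> = 0"
    and indep_increments:
      "\<And>(n::nat) (t :: nat \<Rightarrow> real). 0 \<le> t 0 \<Longrightarrow> (\<And>i. i < n \<Longrightarrow> t i < t (Suc i)) \<Longrightarrow>
         indep_vars (\<lambda>_. borel) (\<lambda>i \<omega>. B (t (Suc i)) \<omega> - B (t i) \<omega>) {..<n}"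
    and gaussian_increments:
      "\<And>s t. 0 \<le> s \<Longrightarrow> s < t \<Longrightarrow>
         distributed M lborel (\<lambda>\<omega>. B t \<omega> - B s \<omega>) (normal_density 0 (sqrt (t - s)))"
    and continuous_paths: "AE \<omega> in M. continuous_on {0..} (\<lambda>t. B t \<omega>)"

text \<open>Extended-real valued, so that the time is \<open>\<infinity>\<close> on paths that never reach the level \<open>a\<close>.\<close>

definition hitting_time :: "(real \<Rightarrow> 'a \<Rightarrow> real) \<Rightarrow> real \<Rightarrow> 'a \<Rightarrow> ereal" where
  "hitting_time B a \<omega> = (INF t\<in>{t. 0 \<le> t \<and> B t \<omega> = a}. ereal t)"

text \<open>
  The expectations of these nonnegative quantities are taken in \<^typ>\<open>ennreal\<close>, so finiteness is not
  presupposed. The integrand's value on \<open>T\<^sub>1 = \<infinity>\<close> (an event of probability zero) is an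
  artefact of \<^const>\<open>real_of_ereal\<close>. The convention \<open>0\<^sup>0 = 0\<close> is that of \<^const>\<open>powr\<close>, for which
  \<open>0 powr 0 = 0\<close>.
\<close>

definition I_plus :: "'a measure \<Rightarrow> (real \<Rightarrow> 'a \<Rightarrow> real) \<Rightarrow> real \<Rightarrow> ennreal" where
  "I_plus M B m =
     (\<integral>\<^sup>+\<omega>. ennreal (1 / real_of_ereal (hitting_time B 1 \<omega>) powr (1 + m / 2) *
        (LBINT s=0..hitting_time B 1 \<omega>. max (B s \<omega>) 0 powr m)) \<partial>M)"

definition I_minus :: "'a measure \<Rightarrow> (real \<Rightarrow> 'a \<Rightarrow> real) \<Rightarrow> real \<Rightarrow> ennreal" where
  "I_minus M B m =
     (\<integral>\<^sup>+\<omega>. ennreal (1 / real_of_ereal (hitting_time B 1 \<omega>) powr (1 + m / 2) *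
        (LBINT s=0..hitting_time B 1 \<omega>. max (- B s \<omega>) 0 powr m)) \<partial>M)"

definition phi :: "real \<Rightarrow> real" where
  "phi m = (LBINT y=0..2. y powr (m + 1) / (1 + y))"

definition c_m :: "real \<Rightarrow> real" where
  "c_m m = Gamma (1 + m) / (2 powr (m / 2) * Gamma (1 + m / 2))"

end

theory Submission
  imports Defs "HOL-Real_Asymp.Real_Asymp"
begin

text \<open>
  Both identities come from one formula for the occupation of the path before the hitting time
  \<open>T = T\<^sub>1\<close>: for every nonnegative Borel function \<open>f\<close>,
  \<open>E[T^(-1 - m/2) \<integral>\<^sub>0\<^sup>T f(B\<^sub>s) ds] = c\<^sub>m \<integral> f(x) (a(x)^(-m-1) - b(x)^(-m-1)) dx\<close>, the last integral being
  over \<open>x < 1\<close>, with \<open>a(x) = \<bar>x\<bar> + 1 - x\<close> and \<open>b(x) = 3 - 2x\<close> (lemma \<open>scaled_occupation\<close>). Taking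
  \<open>f(x) = (x\<^sup>+)^m\<close> and \<open>f(x) = (x\<^sup>-)^m\<close> leaves two elementary integrals
  (\<open>positive_part_integral\<close>, \<open>negative_part_integral\<close>).

  To get the formula, write the power of \<open>T\<close> as a mixture of exponentials,
  \<open>2^(m/2) \<Gamma>(1 + m/2) T^(-1 - m/2) = \<integral>\<^sub>0\<^sup>\<infinity> \<theta>^(m+1) exp(-\<theta>\<^sup>2 T/2) d\<theta>\<close>, so that it suffices to know
  \<open>E[exp(-\<lambda>T) \<integral>\<^sub>0\<^sup>T f(B\<^sub>s) ds]\<close> for \<open>\<lambda> = \<theta>\<^sup>2/2\<close> (lemma \<open>occupation_transform\<close>). On \<open>s < T\<close> the Markov
  property at the fixed time \<open>s\<close> replaces \<open>exp(-\<lambda>T)\<close> by \<open>exp(-\<lambda>s) exp(-\<theta>(1 - B\<^sub>s))\<close>, since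
  \<open>exp(-\<theta>d)\<close> is the Laplace transform of the time needed to climb a distance \<open>d\<close>
  (\<open>hitting_transform_past\<close>). What remains is the resolvent of Brownian motion killed at the level
  \<open>1\<close>, which the reflection principle gives as the free resolvent minus its mirror image
  (\<open>killed_resolvent\<close>). Integrating over \<open>\<theta>\<close> turns each exponential into a power.

  The strong Markov property is needed at \<open>T\<close> only, and only for the functionals
  \<open>\<integral> exp(-\<lambda>r) F(B\<^sub>r) dr\<close> over \<open>r > T\<close> (\<open>strong_markov_resolvent\<close>). For bounded \<open>F\<close> their conditional
  expectation is a continuous function of the position, so they can be handled by approximating \<open>T\<close> from above by
  grid times and using the Markov property at each of these deterministic times. Both the Laplace
  transform of \<open>T\<close> and the reflection principle follow from this one statement by a suitable choice
  of \<open>F\<close>.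

  All expectations are of nonnegative functions and are taken in \<^typ>\<open>ennreal\<close>. On paths that never
  hit \<open>1\<close> the integrand is \<open>0\<close> because \<open>1 / 0 powr p = 0\<close>, so these paths contribute nothing, and
  \<open>T\<close> appears below always together with the event \<open>hits\<close>.
\<close>

section \<open>Integrals in closed form\<close>

abbreviation std_normal_cdf :: "real \<Rightarrow> real" where
  "std_normal_cdf \<equiv> cdf std_normal_distribution"

lemma std_normal_cdf_DERIV:
  "(std_normal_cdf has_real_derivative std_normal_density x) (at x)"
proof -
  interpret real_distribution std_normal_distribution
    by (simp add: real_dist_normal_dist)
  \<comment> \<open>any point to the left of \<open>x\<close> serves as base point of the antiderivative\<close>
  define a where "a = x - 1"
  have int: "set_integrable lborel {a..b} std_normal_density" for b
    unfolding set_integrable_def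
    by (rule integrable_mult_indicator) auto
  have eq: "std_normal_cdf u = std_normal_cdf a + (LBINT y=a..u. std_normal_density y)"
    if "a < u" for u
  proof -
    have "std_normal_cdf u - std_normal_cdf a = measure std_normal_distribution {a<..u}"
      by (rule cdf_diff_eq) fact
    also have "\<dots> = measure std_normal_distribution {a..u}"
      using AE_lborel_singleton[of a]
      by (intro measure_eq_AE) (auto simp: AE_density elim!: eventually_mono)
    also have "\<dots> = (LBINT y=a..u. std_normal_density y)"
    proof -
      have "emeasure std_normal_distribution {a..u} = (\<integral>\<^sup>+y. ennreal (indicator {a..u} y * std_normal_density y) \<partial>lborel)"
        by (simp add: emeasure_density ennreal_mult' ennreal_indicator mult.commute)
      also have "\<dots> = ennreal (LINT y|lborel. indicator {a..u} y * std_normal_density y)"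
        using int[of u] by (intro nn_integral_eq_integral) (auto simp: set_integrable_def)
      finally show ?thesis
        using that by (simp add: interval_integral_Icc set_lebesgue_integral_def measure_def)
    qed
    finally show ?thesis by simp
  qed
  have "((\<lambda>u. LBINT y=a..u. std_normal_density y) has_vector_derivative std_normal_density x) (at x within {a..x+1})"
    by (rule interval_integral_FTC2) (auto simp: a_def normal_density_def intro!: continuous_intros)
  then have "((\<lambda>u. LBINT y=a..u. std_normal_density y) has_real_derivative std_normal_density x) (at x)"
    by (simp add: has_real_derivative_iff_has_vector_derivative at_within_Icc_at a_def)
  then have "((\<lambda>u. std_normal_cdf a + (LBINT y=a..u. std_normal_density y)) has_real_derivative std_normal_density x) (at x)"
    by (auto intro!: derivative_eq_intros)
  then show ?thesis
    by (rule has_field_derivative_transform_within_open[of _ _ _ "{a<..}"]) (auto simp: a_def eq)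
qed

lemma nn_integral_FTC_einterval:
  fixes f F :: "real \<Rightarrow> real" and a b :: ereal
  assumes "a < b"
    and F: "\<And>x. a < ereal x \<Longrightarrow> ereal x < b \<Longrightarrow> DERIV F x :> f x"
    and cont: "\<And>x. a < ereal x \<Longrightarrow> ereal x < b \<Longrightarrow> isCont f x"
    and nonneg: "\<And>x. a < ereal x \<Longrightarrow> ereal x < b \<Longrightarrow> 0 \<le> f x"
    and A: "((F \<circ> real_of_ereal) \<longlongrightarrow> A) (at_right a)"
    and B: "((F \<circ> real_of_ereal) \<longlongrightarrow> B) (at_left b)"
  shows "(\<integral>\<^sup>+x\<in>einterval a b. ennreal (f x) \<partial>lborel) = ennreal (B - A)"
proof -
  have *: "set_integrable lborel (einterval a b) f" "(LBINT x=a..b. f x) = B - A"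
    by (intro interval_integral_FTC_nonneg[where F = F and A = A and B = B] assms AE_I2 impI; assumption)+
  have "(\<integral>\<^sup>+x\<in>einterval a b. ennreal (f x) \<partial>lborel)
      = (\<integral>\<^sup>+x. ennreal (indicator (einterval a b) x * f x) \<partial>lborel)"
    by (intro nn_integral_cong) (auto split: split_indicator)
  also have "\<dots> = ennreal (LINT x|lborel. indicator (einterval a b) x * f x)"
    using *(1) nonneg unfolding set_integrable_def
    by (intro nn_integral_eq_integral) (auto split: split_indicator simp: einterval_iff)
  finally show ?thesis
    using *(2) less_imp_le[OF \<open>a < b\<close>]
    by (simp add: interval_lebesgue_integral_def set_lebesgue_integral_def)
qed

lemma nn_integral_FTC_Ioi:
  fixes f F :: "real \<Rightarrow> real"
  assumes "\<And>x. 0 < x \<Longrightarrow> DERIV F x :> f x"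
    and "\<And>x. 0 < x \<Longrightarrow> isCont f x"
    and "\<And>x. 0 < x \<Longrightarrow> 0 \<le> f x"
    and "(F \<longlongrightarrow> L) (at_right 0)" and "(F \<longlongrightarrow> T) at_top"
  shows "(\<integral>\<^sup>+x\<in>{0<..}. ennreal (f x) \<partial>lborel) = ennreal (T - L)"
proof -
  have ei: "einterval 0 \<infinity> = {0<..}" by (auto simp: einterval_def zero_ereal_def)
  show ?thesis
    unfolding ei[symmetric] using assms
    by (intro nn_integral_FTC_einterval[where F = F]) (auto simp: zero_ereal_def ereal_tendsto_simps)
qed

text \<open>
  The Green function of Brownian motion on the line, obtained from an explicit antiderivative in \<open>t\<close>:
  with \<open>\<Phi>\<close> the standard normal distribution function and \<open>a = \<bar>x\<bar>\<close>, it is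
  \<open>(exp(\<theta>a) \<Phi>(\<theta>\<surd>t + a/\<surd>t) + exp(-\<theta>a) \<Phi>(\<theta>\<surd>t - a/\<surd>t)) / \<theta>\<close>. In its derivative the two exponential
  prefactors complete the squares, and the two terms in \<open>a / t^(3/2)\<close> cancel. As \<open>a > 0\<close>,
  the arguments of \<open>\<Phi>\<close> tend to \<open>\<infinity>\<close> and \<open>-\<infinity>\<close> at \<open>t = 0\<close>.
\<close>

lemma normal_density_Laplace:
  fixes x \<theta> :: real
  assumes \<theta>: "0 < \<theta>" and x: "x \<noteq> 0"
  shows "(\<integral>\<^sup>+t\<in>{0<..}. ennreal (exp (- (\<theta>\<^sup>2 / 2 * t)) * normal_density 0 (sqrt t) x) \<partial>lborel)
    = ennreal (exp (- (\<theta> * \<bar>x\<bar>)) / \<theta>)"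
proof -
  interpret real_distribution std_normal_distribution
    by (simp add: real_dist_normal_dist)
  define a where "a = \<bar>x\<bar>"
  have a: "a > 0" "a^2 = x^2" using x by (auto simp: a_def)
  \<comment> \<open>the antiderivative in \<open>t\<close>\<close>
  define F where "F t = (exp (\<theta> * a) * std_normal_cdf (\<theta> * sqrt t + a / sqrt t)
     + exp (- (\<theta> * a)) * std_normal_cdf (\<theta> * sqrt t - a / sqrt t)) / \<theta>" for t
  have top: "(std_normal_cdf \<longlongrightarrow> 1) at_top" using cdf_lim_at_top_prob .
  have bot: "(std_normal_cdf \<longlongrightarrow> 0) at_bot" using cdf_lim_at_bot .
  have "(\<integral>\<^sup>+t\<in>{0<..}. ennreal (exp (- (\<theta>\<^sup>2 / 2 * t)) * normal_density 0 (sqrt t) x) \<partial>lborel)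
    = ennreal ((exp (\<theta> * a) * 1 + exp (- (\<theta> * a)) * 1) / \<theta> - (exp (\<theta> * a) * 1 + exp (- (\<theta> * a)) * 0) / \<theta>)"
  proof (rule nn_integral_FTC_Ioi[where F = F])
    have l1: "filterlim (\<lambda>t. \<theta> * sqrt t + a / sqrt t) at_top (at_right 0)"
      using \<theta> a by real_asymp
    have l2: "filterlim (\<lambda>t. \<theta> * sqrt t - a / sqrt t) at_bot (at_right 0)"
      using \<theta> a by real_asymp
    have l3: "filterlim (\<lambda>t. \<theta> * sqrt t + a / sqrt t) at_top at_top"
      using \<theta> a by real_asymp
    have l4: "filterlim (\<lambda>t. \<theta> * sqrt t - a / sqrt t) at_top at_top"
      using \<theta> a by real_asymp
    show "(F \<longlongrightarrow> (exp (\<theta> * a) * 1 + exp (- (\<theta> * a)) * 0) / \<theta>) (at_right 0)"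
      unfolding F_def using \<theta>
      by (intro tendsto_intros filterlim_compose[OF top l1] filterlim_compose[OF bot l2]) auto
    show "(F \<longlongrightarrow> (exp (\<theta> * a) * 1 + exp (- (\<theta> * a)) * 1) / \<theta>) at_top"
      unfolding F_def using \<theta>
      by (intro tendsto_intros filterlim_compose[OF top l3] filterlim_compose[OF top l4]) auto
  next
    fix t :: real assume t: "0 < t"
    define r where "r = sqrt t"
    have r: "r > 0" "sqrt t = r" "t = r^2" using t by (auto simp: r_def)
    have sq: "(\<theta> * r + a / r)\<^sup>2 = \<theta>\<^sup>2 * t + 2 * (\<theta> * a) + (x / r)\<^sup>2"
      "(\<theta> * r - a / r)\<^sup>2 = \<theta>\<^sup>2 * t - 2 * (\<theta> * a) + (x / r)\<^sup>2"
      using r(1) a by (simp_all add: power2_sum power2_diff r(3) power_mult_distrib power_divide)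
    \<comment> \<open>the two prefactors turn both squares into the same exponent\<close>
    have e1: "exp (\<theta> * a) * std_normal_density (\<theta> * r + a / r) = exp (- (\<theta>\<^sup>2 / 2 * t)) * std_normal_density (x / r)"
    proof -
      have "\<theta> * a - (\<theta> * r + a / r)\<^sup>2 / 2 = - (\<theta>\<^sup>2 / 2 * t) - (x / r)\<^sup>2 / 2"
        unfolding sq by (simp add: add_divide_distrib diff_divide_distrib)
      then have "exp (\<theta> * a) * exp (- (\<theta> * r + a / r)\<^sup>2 / 2) = exp (- (\<theta>\<^sup>2 / 2 * t)) * exp (- (x / r)\<^sup>2 / 2)"
        by (simp add: exp_add[symmetric])
      then show ?thesis by (simp add: std_normal_density_def)
    qed
    have e2: "exp (- (\<theta> * a)) * std_normal_density (\<theta> * r - a / r) = exp (- (\<theta>\<^sup>2 / 2 * t)) * std_normal_density (x / r)"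
    proof -
      have "- (\<theta> * a) - (\<theta> * r - a / r)\<^sup>2 / 2 = - (\<theta>\<^sup>2 / 2 * t) - (x / r)\<^sup>2 / 2"
        unfolding sq by (simp add: add_divide_distrib diff_divide_distrib)
      then have "exp (- (\<theta> * a)) * exp (- (\<theta> * r - a / r)\<^sup>2 / 2) = exp (- (\<theta>\<^sup>2 / 2 * t)) * exp (- (x / r)\<^sup>2 / 2)"
        by (simp add: exp_add[symmetric])
      then show ?thesis by (simp add: std_normal_density_def)
    qed
    have s: "(sqrt has_real_derivative 1 / (2 * r)) (at t)"
      using DERIV_real_sqrt[OF t] r by (simp add: field_simps)
    have q: "((\<lambda>t. a / sqrt t) has_real_derivative - a / (2 * r ^ 3)) (at t)"
      by (rule derivative_eq_intros s refl)+ (use r in \<open>auto simp: power3_eq_cube\<close>)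
    have d1: "((\<lambda>t. \<theta> * sqrt t + a / sqrt t) has_real_derivative \<theta> / (2 * r) - a / (2 * r ^ 3)) (at t)"
      using DERIV_add[OF DERIV_cmult[OF s, of \<theta>] q] by simp
    have d2: "((\<lambda>t. \<theta> * sqrt t - a / sqrt t) has_real_derivative \<theta> / (2 * r) + a / (2 * r ^ 3)) (at t)"
      using DERIV_diff[OF DERIV_cmult[OF s, of \<theta>] q] by simp
    have d: "DERIV F t :> (exp (\<theta> * a) * (std_normal_density (\<theta> * r + a / r) * (\<theta> / (2 * r) - a / (2 * r ^ 3)))
       + exp (- (\<theta> * a)) * (std_normal_density (\<theta> * r - a / r) * (\<theta> / (2 * r) + a / (2 * r ^ 3)))) / \<theta>"
      unfolding F_def r(2)[symmetric]
      by (intro DERIV_cdivide DERIV_add DERIV_cmult DERIV_chain2[OF std_normal_cdf_DERIV] d1[unfolded r(2)[symmetric]] d2[unfolded r(2)[symmetric]])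
    have "(exp (\<theta> * a) * (std_normal_density (\<theta> * r + a / r) * (\<theta> / (2 * r) - a / (2 * r ^ 3)))
       + exp (- (\<theta> * a)) * (std_normal_density (\<theta> * r - a / r) * (\<theta> / (2 * r) + a / (2 * r ^ 3)))) / \<theta>
       = exp (- (\<theta>\<^sup>2 / 2 * t)) * (std_normal_density (x / r)) * (1 / r)"
      unfolding mult.assoc[symmetric] e1 e2 distrib_left[symmetric]
      using r(1) \<theta> by simp
    also have "\<dots> = exp (- (\<theta>\<^sup>2 / 2 * t)) * normal_density 0 (sqrt t) x"
      using r unfolding normal_density_def 
      by (simp add: power_divide real_sqrt_mult)
    finally show "DERIV F t :> exp (- (\<theta>\<^sup>2 / 2 * t)) * normal_density 0 (sqrt t) x" using d by simp
    show "isCont (\<lambda>t. exp (- (\<theta>\<^sup>2 / 2 * t)) * normal_density 0 (sqrt t) x) t"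
      unfolding normal_density_def using t by (intro continuous_intros) auto
    show "0 \<le> exp (- (\<theta>\<^sup>2 / 2 * t)) * normal_density 0 (sqrt t) x" by simp
  qed
  then show ?thesis using \<theta> by (simp add: a_def diff_divide_distrib[symmetric])
qed

lemma nn_integral_powr_exp:
  fixes a p :: real
  assumes a: "0 < a" and p: "-1 < p"
  shows "(\<integral>\<^sup>+t\<in>{0<..}. ennreal (t powr p * exp (- (t * a))) \<partial>lborel) = ennreal (Gamma (p + 1) * a powr - (p + 1))"
proof -
  have "ennreal (Gamma (p + 1)) = (\<integral>\<^sup>+t\<in>{0<..}. ennreal (t powr p * exp (- t)) \<partial>lborel)"
    using p by (subst Gamma_conv_nn_integral_real)
      (auto intro!: nn_integral_cong simp: exp_minus field_simps split: split_indicator)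
  also have "\<dots> = ennreal \<bar>a\<bar> * (\<integral>\<^sup>+t. ennreal ((0 + a * t) powr p * exp (- (0 + a * t))) * indicator {0<..} (0 + a * t) \<partial>lborel)"
    using a by (intro nn_integral_real_affine) auto
  also have "\<dots> = (\<integral>\<^sup>+t. ennreal (a powr (p + 1)) * (ennreal (t powr p * exp (- (t * a))) * indicator {0<..} t) \<partial>lborel)"
    using a by (subst nn_integral_cmult[symmetric]) 
      (auto intro!: nn_integral_cong simp: powr_mult powr_add zero_less_mult_iff ennreal_mult[symmetric] mult_ac split: split_indicator)
  also have "\<dots> = ennreal (a powr (p + 1)) * (\<integral>\<^sup>+t\<in>{0<..}. ennreal (t powr p * exp (- (t * a))) \<partial>lborel)"
    by (intro nn_integral_cmult) auto
  finally have "ennreal (a powr - (p + 1)) * ennreal (Gamma (p + 1)) =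
     ennreal (a powr - (p + 1)) * ennreal (a powr (p + 1)) * (\<integral>\<^sup>+t\<in>{0<..}. ennreal (t powr p * exp (- (t * a))) \<partial>lborel)"
    by (simp add: mult.assoc)
  also have "ennreal (a powr - (p + 1)) * ennreal (a powr (p + 1)) = 1"
    using a by (simp add: ennreal_mult[symmetric] powr_add[symmetric] del: minus_add_distrib)
  finally show ?thesis using p by (simp add: ennreal_mult' mult.commute)
qed

text \<open>
  This represents a negative power of \<open>T\<close> as a mixture of the exponentials \<open>exp(-\<theta>\<^sup>2 T/2)\<close>. The rate is
  parametrised by \<open>\<theta>\<^sup>2/2\<close> and not by \<open>\<lambda>\<close> because every transform of Brownian motion below is a plain
  exponential in \<open>\<theta> = \<surd>(2\<lambda>)\<close>. The substitution \<open>\<theta> = \<surd>(2u)\<close> reduces the integral to Euler's.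
\<close>

lemma Gamma_integral_half_square:
  fixes m T :: real
  assumes T: "0 < T" and m: "0 \<le> m"
  shows "(\<integral>\<^sup>+\<theta>\<in>{0<..}. ennreal (\<theta> powr (m + 1) * exp (- (\<theta>\<^sup>2 / 2 * T))) \<partial>lborel)
    = ennreal (2 powr (m / 2) * Gamma (1 + m / 2) / T powr (1 + m / 2))"
proof -
  define f where "f \<theta> = \<theta> powr (m + 1) * exp (- (\<theta>\<^sup>2 / 2 * T))" for \<theta>
  define g :: "real \<Rightarrow> real" where "g u = sqrt (2 * u)" for u
  define g' :: "real \<Rightarrow> real" where "g' u = 1 / sqrt (2 * u)" for u
  let ?c = "2 powr (m / 2) * Gamma (1 + m / 2) / T powr (1 + m / 2)"
  have c: "0 \<le> ?c" using m by (auto intro!: divide_nonneg_nonneg mult_nonneg_nonneg Gamma_real_nonneg)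
  have ei: "einterval 0 \<infinity> = {0<..}" by (auto simp: einterval_def zero_ereal_def)
  have fg: "f (g u) * g' u = 2 powr (m / 2) * (u powr (m / 2) * exp (- (u * T)))" if "0 < u" for u
  proof -
    have "sqrt (2 * u) powr m = 2 powr (m / 2) * u powr (m / 2)"
      using that by (simp add: powr_half_sqrt[symmetric] powr_powr powr_mult)
    then show ?thesis
      using that by (simp add: f_def g_def g'_def powr_add mult.assoc)
  qed
  have "(\<integral>\<^sup>+u. ennreal (indicator {0<..} u * (f (g u) * g' u)) \<partial>lborel)
     = (\<integral>\<^sup>+u. ennreal (2 powr (m / 2)) * (ennreal (u powr (m/2) * exp (- (u * T))) * indicator {0<..} u) \<partial>lborel)"
    by (intro nn_integral_cong) (auto simp: fg ennreal_mult' split: split_indicator)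
  also have "\<dots> = ennreal (2 powr (m / 2)) * ennreal (Gamma (m / 2 + 1) * T powr - (m / 2 + 1))"
    using T m by (subst nn_integral_cmult) (auto simp: nn_integral_powr_exp)
  also have "\<dots> = ennreal ?c"
    by (simp only: ennreal_mult'[symmetric] powr_minus powr_ge_zero) (simp add: field_simps)
  finally have nn: "(\<integral>\<^sup>+u. ennreal (indicator {0<..} u * (f (g u) * g' u)) \<partial>lborel) = ennreal ?c" .
  have hb: "has_bochner_integral lborel (\<lambda>u. indicator {0<..} u * (f (g u) * g' u)) ?c"
    by (rule has_bochner_integral_nn_integral[OF _ _ _ nn])
       (use c in \<open>auto simp: f_def g_def g'_def split: split_indicator\<close>)
  have pos: "DERIV g x :> g' x" "isCont f (g x)" "isCont g' x" "0 \<le> f (g x)" if "0 < ereal x" for x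
  proof -
    from that have x: "0 < x" by simp
    show "DERIV g x :> g' x" using x unfolding g_def g'_def
      by (auto intro!: derivative_eq_intros simp: field_simps)
    show "isCont f (g x)" using x unfolding f_def g_def by (intro continuous_intros) auto
    show "isCont g' x" using x unfolding g'_def by (intro continuous_intros) auto
    show "0 \<le> f (g x)" by (simp add: f_def)
  qed
  have lims: "((ereal \<circ> g \<circ> real_of_ereal) \<longlongrightarrow> 0) (at_right 0)"
      "((ereal \<circ> g \<circ> real_of_ereal) \<longlongrightarrow> \<infinity>) (at_left \<infinity>)"
  proof -
    have "(g \<longlongrightarrow> 0) (at_right 0)" "filterlim g at_top at_top" unfolding g_def by real_asymp+
    then show "((ereal \<circ> g \<circ> real_of_ereal) \<longlongrightarrow> 0) (at_right 0)"
      "((ereal \<circ> g \<circ> real_of_ereal) \<longlongrightarrow> \<infinity>) (at_left \<infinity>)"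
      by (auto simp: zero_ereal_def comp_assoc[symmetric] ereal_tendsto_simps)
  qed
  have int: "set_integrable lborel (einterval 0 \<infinity>) (\<lambda>x. f (g x) * g' x)"
    using hb by (simp add: ei set_integrable_def has_bochner_integral_iff)
  have sub: "set_integrable lborel (einterval 0 \<infinity>) f" "(LBINT x=0..\<infinity>. f x) = (LBINT x=0..\<infinity>. f (g x) * g' x)"
    using interval_integral_substitution_nonneg[of 0 \<infinity> g g' f, OF _ pos(1,2,3,4) _ lims int]
    by (auto simp: g'_def)
  have "(\<integral>\<^sup>+\<theta>\<in>{0<..}. ennreal (f \<theta>) \<partial>lborel) = (\<integral>\<^sup>+x. ennreal (indicator {0<..} x * f x) \<partial>lborel)"
    by (intro nn_integral_cong) (auto split: split_indicator)
  also have "\<dots> = ennreal (LINT x|lborel. indicator {0<..} x * f x)"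
    using sub(1) by (intro nn_integral_eq_integral) (auto simp: set_integrable_def ei f_def)
  also have "(LINT x|lborel. indicator {0<..} x * f x) = ?c"
    using sub(2) hb
    by (simp add: interval_lebesgue_integral_def ei set_lebesgue_integral_def has_bochner_integral_iff)
  finally show ?thesis by (simp add: f_def)
qed

text \<open>
  The factor \<open>1/\<theta>\<close> comes from the Green function and lowers the exponent of \<open>\<theta>\<close> by one, so that each of
  the two exponentials integrates to a Gamma value. The difference is taken after the integration, by
  cancelling a finite term, as subtraction of infinite integrals would be meaningless.
\<close>

lemma integral_exp_difference:
  fixes a b m :: real
  assumes a: "0 < a" "a \<le> b" and m: "0 \<le> m"
  shows "(\<integral>\<^sup>+\<theta>\<in>{0<..}. ennreal (\<theta> powr (m + 1) * ((exp (- (\<theta> * a)) - exp (- (\<theta> * b))) / \<theta>)) \<partial>lborel)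
    = ennreal (Gamma (1 + m) * (a powr - (m + 1) - b powr - (m + 1)))" (is "?I = _")
proof -
  have le: "b powr - (m + 1) \<le> a powr - (m + 1)"
    using a m by (intro powr_mono2') auto
  have "ennreal (Gamma (m + 1) * a powr - (m + 1)) = (\<integral>\<^sup>+t\<in>{0<..}. ennreal (t powr m * exp (- (t * a))) \<partial>lborel)"
    using a m by (subst nn_integral_powr_exp) auto
  also have "\<dots> = (\<integral>\<^sup>+t. ennreal (t powr (m + 1) * ((exp (- (t * a)) - exp (- (t * b))) / t)) * indicator {0<..} t
       + ennreal (t powr m * exp (- (t * b))) * indicator {0<..} t \<partial>lborel)"
    using a by (intro nn_integral_cong) (auto simp: powr_add ennreal_plus[symmetric] field_simps simp del: ennreal_plus split: split_indicator)
  also have "\<dots> = ?I + ennreal (Gamma (m + 1) * b powr - (m + 1))"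
    using a m by (subst nn_integral_add) (auto simp: nn_integral_powr_exp)
  finally have "?I + ennreal (Gamma (m + 1) * b powr - (m + 1)) = ennreal (Gamma (1 + m) * (a powr - (m + 1) - b powr - (m + 1))) + ennreal (Gamma (m + 1) * b powr - (m + 1))"
    using le m by (subst ennreal_plus[symmetric]) (auto simp: algebra_simps)
  then show ?thesis
    using ennreal_add_left_cancel[of "ennreal (Gamma (m + 1) * b powr - (m + 1))" ?I]
    by (simp add: add.commute)
qed

lemma DERIV_powr_add_one:
  fixes m w' :: real
  assumes "DERIV w x :> w'" "0 < w x"
  shows "((\<lambda>x. w x powr (m + 1)) has_real_derivative (m + 1) * w x powr m * w') (at x)"
  using assms by (auto intro!: derivative_eq_intros)

text \<open>
  The substitution \<open>y = 2x / (3 - 2x)\<close> maps \<open>(0,1)\<close> to \<open>(0,2)\<close> and \<open>x^m (3 - 2x)^(-m-1) dx\<close> to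
  \<open>2^(-m-1) y^m / (1 + y) dy\<close>, while \<open>\<integral>\<^sub>0\<^sup>1 x^m dx = 2^(-m-1) \<integral>\<^sub>0\<^sup>2 y^m dy\<close>; and
  \<open>y^m - y^m / (1 + y) = y^(m+1) / (1 + y)\<close>. In the proof this is an antiderivative \<open>F\<close> in \<open>x\<close> built from the
  integral function \<open>G\<close> of \<open>y^(m+1) / (1 + y)\<close>, whose integrand is continuous at \<open>0\<close> for every
  \<open>m \<ge> 0\<close> (that of \<open>y^m / (1 + y)\<close> is not for \<open>m = 0\<close>, where \<open>0 powr 0 = 0\<close>).
\<close>

lemma positive_part_integral:
  fixes m :: real
  assumes m: "0 \<le> m"
  shows "(\<integral>\<^sup>+x\<in>{0<..<1}. ennreal (x powr m * (1 - (3 - 2 * x) powr - (m + 1))) \<partial>lborel) = ennreal (phi m / 2 powr (m + 1))"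
proof -
  define h where "h y = y powr (m + 1) / (1 + y)" for y :: real
  define G where "G u = (LBINT y=0..u. h y)" for u :: real
  define v where "v x = 2 * x / (3 - 2 * x)" for x :: real
  define F where "F x = x powr (m + 1) / (m + 1) - (v x powr (m + 1) / (m + 1) - G (v x)) / 2 powr (m + 1)" for x
  have hc: "continuous_on {0..2} h"
    unfolding h_def using m by (intro continuous_intros continuous_on_powr') auto
  have G2: "(G has_vector_derivative h u) (at u within {0..2})" if "0 \<le> u" "u \<le> 2" for u
    unfolding G_def zero_ereal_def by (rule interval_integral_FTC2) (use that hc in auto)
  have Gc: "continuous_on {0..2} G"
    using G2 by (meson atLeastAtMost_iff continuous_on_eq_continuous_within has_vector_derivative_continuous)
  have G: "DERIV G u :> h u" if "0 < u" "u < 2" for u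
    using G2[of u] that by (simp add: has_real_derivative_iff_has_vector_derivative at_within_Icc_at)
  have ei: "einterval 0 1 = {0<..<1::real}" by (auto simp: einterval_def zero_ereal_def one_ereal_def)
  have "(\<integral>\<^sup>+x\<in>einterval 0 1. ennreal (x powr m * (1 - (3 - 2 * x) powr - (m + 1))) \<partial>lborel) = ennreal (F 1 - F 0)"
  proof (rule nn_integral_FTC_einterval[where F = F])
    have vc: "continuous_on {0..1} v" unfolding v_def by (intro continuous_intros) auto
    have Fc: "continuous_on {0..1} F" unfolding F_def using m
      by (intro continuous_intros continuous_on_powr' vc continuous_on_compose2[OF Gc vc]) (auto simp: v_def field_simps)
    show "((F \<circ> real_of_ereal) \<longlongrightarrow> F 0) (at_right 0)"
      using Fc by (simp add: zero_ereal_def ereal_tendsto_simps continuous_on_Icc_at_rightD)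
    show "((F \<circ> real_of_ereal) \<longlongrightarrow> F 1) (at_left 1)"
      using Fc by (simp add: one_ereal_def ereal_tendsto_simps continuous_on_Icc_at_leftD)
  next
    fix x :: real assume "0 < ereal x" "ereal x < 1"
    then have x: "0 < x" "x < 1" by auto
    define d where "d = 3 - 2 * x"
    have d: "d > 0" "d \<ge> 1" using x by (auto simp: d_def)
    show "isCont (\<lambda>x. x powr m * (1 - (3 - 2 * x) powr - (m + 1))) x"
      using x by (intro continuous_intros) auto
    have "(3 - 2 * x) powr - (m + 1) \<le> 1 powr - (m + 1)"
      using x m by (intro powr_mono2') auto
    then show "0 \<le> x powr m * (1 - (3 - 2 * x) powr - (m + 1))" by simp
    have v: "0 < v x" "v x < 2" using x by (auto simp: v_def field_simps)
    have dv: "DERIV v x :> 6 / d\<^sup>2"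
      unfolding v_def d_def using x
      by (auto intro!: derivative_eq_intros simp: field_simps power2_eq_square)
    have pw: "((\<lambda>x. w x powr (m + 1) / (m + 1)) has_real_derivative w x powr m * w') (at x)"
      if "DERIV w x :> w'" "0 < w x" for w w'
      using DERIV_cdivide[OF DERIV_powr_add_one[OF that, of m], of "m + 1"] m by simp
    have "DERIV F x :> x powr m - (v x powr m * (6 / d\<^sup>2) - h (v x) * (6 / d\<^sup>2)) / 2 powr (m + 1)"
      unfolding F_def using pw[of "\<lambda>x. x" 1] x v
      by (intro DERIV_diff DERIV_cdivide DERIV_chain2[OF G dv] pw dv) auto
    also have "x powr m - (v x powr m * (6 / d\<^sup>2) - h (v x) * (6 / d\<^sup>2)) / 2 powr (m + 1)
      = x powr m - (v x powr m - h (v x)) * (6 / d\<^sup>2) / 2 powr (m + 1)"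
      by (simp only: left_diff_distrib)
    also have "v x powr m - h (v x) = v x powr m / (1 + v x)"
      using v by (simp add: h_def powr_add field_simps)
    also have "v x powr m / (1 + v x) * (6 / d\<^sup>2) / 2 powr (m + 1) = x powr m * d powr - (m + 1)"
    proof -
      have "1 + v x = 3 / d" using d by (simp add: v_def d_def field_simps)
      moreover have "v x powr m = 2 powr m * x powr m * d powr - m"
        using x d unfolding v_def d_def[symmetric] by (simp add: powr_divide powr_mult powr_minus field_simps)
      moreover have "d powr - (m + 1) = d powr - m / d"
        using d powr_diff[of d "- m" 1] by simp
      moreover have "(2::real) powr (m + 1) = 2 * 2 powr m"
        by (simp add: powr_add)
      ultimately show ?thesis
        using d by (simp only:) (simp add: power2_eq_square field_simps)
    qed
    finally show "DERIV F x :> x powr m * (1 - (3 - 2 * x) powr - (m + 1))"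
      by (simp add: d_def algebra_simps)
  qed simp
  also have "F 1 - F 0 = phi m / 2 powr (m + 1)"
  proof -
    have "F 0 = 0" using m by (simp add: F_def v_def G_def zero_ereal_def[symmetric])
    moreover have "F 1 = G 2 / 2 powr (m + 1)"
      by (simp add: F_def v_def diff_divide_distrib)
    ultimately show ?thesis by (simp add: G_def phi_def h_def)
  qed
  finally show ?thesis by (simp add: ei)
qed

text \<open>
  A Frullani integral: the difference of powers is \<open>\<integral>\<^sub>1\<^sup>3 (m + 1) (a + 2y)^(-m-2) da\<close>. After exchanging the
  integrals, \<open>(1/a) (y / (a + 2y))^(m+1)\<close> is an antiderivative in \<open>y\<close>, which contributes
  \<open>2^(-m-1) / a\<close>, and \<open>\<integral>\<^sub>1\<^sup>3 da / a = ln 3\<close>.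
\<close>

lemma negative_part_integral:
  fixes m :: real
  assumes m: "0 \<le> m"
  shows "(\<integral>\<^sup>+y\<in>{0<..}. ennreal (y powr m * ((1 + 2 * y) powr - (m + 1) - (3 + 2 * y) powr - (m + 1))) \<partial>lborel) = ennreal (ln 3 / 2 powr (m + 1))"
proof -
  have "(\<integral>\<^sup>+y\<in>{0<..}. ennreal (y powr m * ((1 + 2 * y) powr - (m + 1) - (3 + 2 * y) powr - (m + 1))) \<partial>lborel)
    = (\<integral>\<^sup>+y. \<integral>\<^sup>+a. ennreal ((m + 1) * y powr m * (a + 2 * y) powr - (m + 2)) * indicator {1..3} a * indicator {0<..} y \<partial>lborel \<partial>lborel)"
  proof (intro nn_integral_cong, goal_cases)
    case (1 y)
    have "(\<integral>\<^sup>+a. ennreal ((m + 1) * y powr m * (a + 2 * y) powr - (m + 2)) * indicator {1..3} a \<partial>lborel)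
       = ennreal (- (y powr m * (3 + 2 * y) powr - (m + 1)) - - (y powr m * (1 + 2 * y) powr - (m + 1)))" if "0 < y"
    proof (rule nn_integral_FTC_Icc)
      fix x :: real assume x: "x \<in> {1..3}"
      show "((\<lambda>a. - (y powr m * (a + 2 * y) powr - (m + 1))) has_real_derivative
         (m + 1) * y powr m * (x + 2 * y) powr - (m + 2)) (at x)"
        using that x by (auto intro!: derivative_eq_intros simp: algebra_simps)
      show "0 \<le> (m + 1) * y powr m * (x + 2 * y) powr - (m + 2)" using m by simp
    qed auto
    then show ?case by (auto split: split_indicator simp: algebra_simps)
  qed
  also have "\<dots> = (\<integral>\<^sup>+a. \<integral>\<^sup>+y. ennreal ((m + 1) * y powr m * (a + 2 * y) powr - (m + 2)) * indicator {1..3} a * indicator {0<..} y \<partial>lborel \<partial>lborel)"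
    by (intro lborel_pair.Fubini') measurable
  also have "\<dots> = (\<integral>\<^sup>+a\<in>{1..3}. ennreal (1 / a * (1/2) powr (m + 1)) \<partial>lborel)"
  proof (intro nn_integral_cong, goal_cases)
    case (1 a)
    have "(\<integral>\<^sup>+y\<in>{0<..}. ennreal ((m + 1) * y powr m * (a + 2 * y) powr - (m + 2)) \<partial>lborel) = ennreal (1 / a * (1/2) powr (m + 1) - 0)" if a: "1 \<le> a"
    proof (rule nn_integral_FTC_Ioi[where F = "\<lambda>y. 1 / a * (y / (a + 2 * y)) powr (m + 1)"])
      fix y :: real assume y: "0 < y"
      have d: "((\<lambda>y. y / (a + 2 * y)) has_real_derivative a / (a + 2 * y)\<^sup>2) (at y)"
        using a y by (auto intro!: derivative_eq_intros simp: field_simps power2_eq_square)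
      have "((\<lambda>y. 1 / a * (y / (a + 2 * y)) powr (m + 1)) has_real_derivative
         1 / a * ((m + 1) * (y / (a + 2 * y)) powr m * (a / (a + 2 * y)\<^sup>2))) (at y)"
        using a y by (intro DERIV_cmult DERIV_powr_add_one d) auto
      also have "1 / a * ((m + 1) * (y / (a + 2 * y)) powr m * (a / (a + 2 * y)\<^sup>2)) = (m + 1) * y powr m * (a + 2 * y) powr - (m + 2)"
      proof -
        have "(a + 2 * y) powr - (m + 2) = (a + 2 * y) powr - m / (a + 2 * y)\<^sup>2"
          using a y powr_diff[of "a + 2 * y" "- m" 2] by simp
        moreover have "(y / (a + 2 * y)) powr m = y powr m * (a + 2 * y) powr - m"
          using a y by (simp add: powr_divide powr_minus field_simps)
        ultimately show ?thesis using a by (simp only:) simp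
      qed
      finally show "((\<lambda>y. 1 / a * (y / (a + 2 * y)) powr (m + 1)) has_real_derivative
         (m + 1) * y powr m * (a + 2 * y) powr - (m + 2)) (at y)" .
      show "isCont (\<lambda>y. (m + 1) * y powr m * (a + 2 * y) powr - (m + 2)) y"
        using a y by (intro continuous_intros) auto
      show "0 \<le> (m + 1) * y powr m * (a + 2 * y) powr - (m + 2)" using m by simp
    next
      have "((\<lambda>y. y / (a + 2 * y)) \<longlongrightarrow> 0) (at_right 0)" using a by real_asymp
      then have "((\<lambda>y. 1 / a * (y / (a + 2 * y)) powr (m + 1)) \<longlongrightarrow> 1 / a * 0 powr (m + 1)) (at_right 0)"
        using m a by (intro tendsto_intros) (auto simp: eventually_at_right_less intro!: eventually_at_right_less[THEN eventually_mono])
      then show "((\<lambda>y. 1 / a * (y / (a + 2 * y)) powr (m + 1)) \<longlongrightarrow> 0) (at_right 0)" using m by simp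
      have "((\<lambda>y. y / (a + 2 * y)) \<longlongrightarrow> 1/2) at_top" using a by real_asymp
      then show "((\<lambda>y. 1 / a * (y / (a + 2 * y)) powr (m + 1)) \<longlongrightarrow> 1 / a * (1/2) powr (m + 1)) at_top"
        by (intro tendsto_mult tendsto_powr tendsto_const) auto
    qed
    then show ?case by (auto split: split_indicator)
  qed
  also have "\<dots> = ennreal (ln 3 * (1/2) powr (m + 1) - ln 1 * (1/2) powr (m + 1))"
    by (rule nn_integral_FTC_Icc)
       (auto intro!: derivative_eq_intros simp: field_simps)
  finally show ?thesis by (simp add: powr_divide)
qed

section \<open>The resolvent of Brownian motion\<close>

text \<open>
  The resolvent \<open>\<integral>\<^sub>0\<^sup>\<infinity> exp(-\<theta>\<^sup>2 r/2) E[F(x + B\<^sub>r)] dr\<close>, given by its Green kernel; the lemma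
  \<open>Laplace_heat_semigroup\<close> below is the justification.
\<close>

definition potential :: "real \<Rightarrow> (real \<Rightarrow> ennreal) \<Rightarrow> real \<Rightarrow> ennreal" where
  "potential \<theta> F x = (\<integral>\<^sup>+y. ennreal (exp (- (\<theta> * \<bar>y - x\<bar>)) / \<theta>) * F y \<partial>lborel)"

lemma borel_measurable_potential [measurable]:
  assumes [measurable]: "F \<in> borel_measurable borel"
  shows "potential \<theta> F \<in> borel_measurable borel"
  unfolding potential_def[abs_def] by measurable

lemma borel_measurable_normal_density_sqrt [measurable]:
  assumes [measurable]: "f \<in> borel_measurable N" "g \<in> borel_measurable N"
  shows "(\<lambda>w. normal_density 0 (sqrt (f w)) (g w)) \<in> borel_measurable N"
  unfolding normal_density_def by measurable

text \<open>
  Tonelli's theorem and the Laplace transform of the heat kernel. The starting time \<open>t\<close> is kept, as this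
  is the form in which the Markov property at time \<open>t\<close> produces the integral.
\<close>

lemma Laplace_heat_semigroup:
  fixes F :: "real \<Rightarrow> ennreal" and \<theta> t x :: real
  assumes \<theta>: "0 < \<theta>" and [measurable]: "F \<in> borel_measurable borel"
  shows "(\<integral>\<^sup>+r\<in>{t<..}. ennreal (exp (- (\<theta>\<^sup>2 / 2 * r))) *
            (\<integral>\<^sup>+y. ennreal (normal_density 0 (sqrt (r - t)) (y - x)) * F y \<partial>lborel) \<partial>lborel)
     = ennreal (exp (- (\<theta>\<^sup>2 / 2 * t))) * potential \<theta> F x"
proof -
  let ?e = "\<lambda>r. exp (- (\<theta>\<^sup>2 / 2 * r))"
  let ?p = "\<lambda>v y. normal_density 0 (sqrt v) (y - x)"
  have "(\<integral>\<^sup>+r\<in>{t<..}. ennreal (?e r) * (\<integral>\<^sup>+y. ennreal (?p (r - t) y) * F y \<partial>lborel) \<partial>lborel)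
     = (\<integral>\<^sup>+r. \<integral>\<^sup>+y. ennreal (?e r * ?p (r - t) y) * indicator {t<..} r * F y \<partial>lborel \<partial>lborel)"
  proof (intro nn_integral_cong, goal_cases)
    case (1 r)
    have "(\<integral>\<^sup>+y. ennreal (?e r * ?p (r - t) y) * indicator {t<..} r * F y \<partial>lborel)
      = (\<integral>\<^sup>+y. (ennreal (?e r) * indicator {t<..} r) * (ennreal (?p (r - t) y) * F y) \<partial>lborel)"
      by (intro nn_integral_cong) (simp add: ennreal_mult mult_ac)
    also have "\<dots> = (ennreal (?e r) * indicator {t<..} r) * (\<integral>\<^sup>+y. ennreal (?p (r - t) y) * F y \<partial>lborel)"
      by (intro nn_integral_cmult) measurable
    finally show ?case by (simp add: mult_ac)
  qed
  also have "\<dots> = (\<integral>\<^sup>+y. \<integral>\<^sup>+r. ennreal (?e r * ?p (r - t) y) * indicator {t<..} r * F y \<partial>lborel \<partial>lborel)"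
    by (intro lborel_pair.Fubini') measurable
  also have "\<dots> = (\<integral>\<^sup>+y. ennreal (?e t) * (ennreal (exp (- (\<theta> * \<bar>y - x\<bar>)) / \<theta>) * F y) \<partial>lborel)"
  proof (rule nn_integral_cong_AE, rule AE_mp[OF AE_lborel_singleton[of x]], rule AE_I2, rule impI)
    fix y :: real assume "y \<noteq> x"
    have "(\<integral>\<^sup>+r. ennreal (?e r * ?p (r - t) y) * indicator {t<..} r * F y \<partial>lborel)
      = (\<integral>\<^sup>+r. ennreal (?e r * ?p (r - t) y) * indicator {t<..} r \<partial>lborel) * F y"
      by (intro nn_integral_multc) measurable
    also have "(\<integral>\<^sup>+r. ennreal (?e r * ?p (r - t) y) * indicator {t<..} r \<partial>lborel)
      = (\<integral>\<^sup>+v. ennreal (?e (t + v) * ?p v y) * indicator {t<..} (t + v) \<partial>lborel)"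
      by (subst nn_integral_real_affine[where c = 1 and t = t]) auto
    also have "\<dots> = (\<integral>\<^sup>+v. ennreal (?e t) * (ennreal (?e v * ?p v y) * indicator {0<..} v) \<partial>lborel)"
      by (intro nn_integral_cong)
         (auto simp: distrib_left exp_add[symmetric] exp_minus ennreal_mult[symmetric] exp_diff field_simps split: split_indicator)
    also have "\<dots> = ennreal (?e t) * ennreal (exp (- (\<theta> * \<bar>y - x\<bar>)) / \<theta>)"
      using normal_density_Laplace[OF \<theta>, of "y - x"] \<open>y \<noteq> x\<close> by (subst nn_integral_cmult) auto
    finally show "(\<integral>\<^sup>+r. ennreal (?e r * ?p (r - t) y) * indicator {t<..} r * F y \<partial>lborel)
       = ennreal (?e t) * (ennreal (exp (- (\<theta> * \<bar>y - x\<bar>)) / \<theta>) * F y)"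
      by (simp add: mult.assoc)
  qed
  also have "\<dots> = ennreal (?e t) * potential \<theta> F x"
    unfolding potential_def by (intro nn_integral_cmult) measurable
  finally show ?thesis .
qed

lemma nn_integral_exp_Ioi:
  fixes c t :: real
  assumes "0 < c"
  shows "(\<integral>\<^sup>+r\<in>{t<..}. ennreal (exp (- (c * r))) \<partial>lborel) = ennreal (exp (- (c * t)) / c)"
proof -
  have lim: "((\<lambda>r. - exp (- (c * r)) / c) \<longlongrightarrow> - 0 / c) at_top"
    using assms by (intro tendsto_intros filterlim_compose[OF exp_at_bot]
      filterlim_compose[OF filterlim_uminus_at_bot_at_top] filterlim_tendsto_pos_mult_at_top[OF tendsto_const] filterlim_ident) auto
  have "(\<integral>\<^sup>+r\<in>{t<..}. ennreal (exp (- (c * r))) \<partial>lborel) = (\<integral>\<^sup>+r. ennreal (exp (- (c * r))) * indicator {t..} r \<partial>lborel)"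
    using AE_lborel_singleton[of t]
    by (intro nn_integral_cong_AE) (auto elim!: eventually_mono split: split_indicator)
  also have "\<dots> = ennreal (- 0 / c - (- exp (- (c * t)) / c))"
    using assms lim by (intro nn_integral_FTC_atLeast) (auto intro!: derivative_eq_intros)
  finally show ?thesis by simp
qed

text \<open>
  The bound is \<open>\<integral>\<^sub>0\<^sup>\<infinity> exp(-\<theta>\<^sup>2 r/2) dr\<close>: the heat semigroup does not increase the supremum.
\<close>

lemma potential_le:
  assumes \<theta>: "0 < \<theta>" and F[measurable]: "F \<in> borel_measurable borel" and le: "\<And>y. F y \<le> 1"
  shows "potential \<theta> F x \<le> ennreal (2 / \<theta>\<^sup>2)"
proof -
  have "potential \<theta> F x = (\<integral>\<^sup>+r\<in>{0<..}. ennreal (exp (- (\<theta>\<^sup>2 / 2 * r))) *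
            (\<integral>\<^sup>+y. ennreal (normal_density 0 (sqrt (r - 0)) (y - x)) * F y \<partial>lborel) \<partial>lborel)"
    using Laplace_heat_semigroup[OF \<theta> F, of 0 x] by simp
  also have "\<dots> \<le> (\<integral>\<^sup>+r\<in>{0<..}. ennreal (exp (- (\<theta>\<^sup>2 / 2 * r))) \<partial>lborel)"
  proof (intro nn_integral_mono, goal_cases)
    case (1 r)
    have "(\<integral>\<^sup>+y. ennreal (normal_density 0 (sqrt r) (y - x)) * F y \<partial>lborel) \<le> 1" if "0 < r"
    proof -
      have "(\<integral>\<^sup>+y. ennreal (normal_density 0 (sqrt r) (y - x)) * F y \<partial>lborel)
         \<le> (\<integral>\<^sup>+y. ennreal (normal_density x (sqrt r) y) \<partial>lborel)"
        using le by (intro nn_integral_mono) (auto simp: normal_density_def intro!: mult_left_le)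
      also have "\<dots> = 1"
        using prob_space.emeasure_space_1[OF prob_space_normal_density[of "sqrt r" x]] that
        by (simp add: emeasure_density)
      finally show ?thesis .
    qed
    then show ?case by (auto intro!: mult_left_le split: split_indicator)
  qed
  also have "\<dots> = ennreal (2 / \<theta>\<^sup>2)"
    using \<theta> by (subst nn_integral_exp_Ioi) auto
  finally show ?thesis .
qed

text \<open>
  The Green kernel itself satisfies this inequality in its first argument, by the triangle inequality.
  It makes the potential of a bounded function continuous without any regularity of the function.
\<close>

lemma potential_le_exp_dist:
  assumes \<theta>: "0 < \<theta>" and [measurable]: "F \<in> borel_measurable borel"
  shows "potential \<theta> F x \<le> ennreal (exp (\<theta> * \<bar>x - x'\<bar>)) * potential \<theta> F x'"
proof -
  have "potential \<theta> F x \<le> (\<integral>\<^sup>+y. ennreal (exp (\<theta> * \<bar>x - x'\<bar>)) * (ennreal (exp (- (\<theta> * \<bar>y - x'\<bar>)) / \<theta>) * F y) \<partial>lborel)"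
    unfolding potential_def
  proof (intro nn_integral_mono, goal_cases)
    case (1 y)
    have "\<theta> * \<bar>y - x'\<bar> \<le> \<theta> * (\<bar>x - x'\<bar> + \<bar>y - x\<bar>)" using \<theta> by (intro mult_left_mono) auto
    then have "exp (- (\<theta> * \<bar>y - x\<bar>)) \<le> exp (\<theta> * \<bar>x - x'\<bar>) * exp (- (\<theta> * \<bar>y - x'\<bar>))"
      by (simp add: exp_add[symmetric] algebra_simps)
    then have "exp (- (\<theta> * \<bar>y - x\<bar>)) / \<theta> \<le> exp (\<theta> * \<bar>x - x'\<bar>) * (exp (- (\<theta> * \<bar>y - x'\<bar>)) / \<theta>)"
      using \<theta> by (simp add: divide_right_mono)
    then have "ennreal (exp (- (\<theta> * \<bar>y - x\<bar>)) / \<theta>) \<le> ennreal (exp (\<theta> * \<bar>x - x'\<bar>)) * ennreal (exp (- (\<theta> * \<bar>y - x'\<bar>)) / \<theta>)"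
      using \<theta> by (simp add: ennreal_mult[symmetric])
    then show ?case by (auto simp: mult.assoc[symmetric] intro!: mult_right_mono)
  qed
  also have "\<dots> = ennreal (exp (\<theta> * \<bar>x - x'\<bar>)) * potential \<theta> F x'"
    unfolding potential_def by (intro nn_integral_cmult) measurable
  finally show ?thesis .
qed

lemma potential_tendsto:
  assumes \<theta>: "0 < \<theta>" and F: "F \<in> borel_measurable borel" and le: "\<And>y. F y \<le> 1"
    and x: "x \<longlonglongrightarrow> x0"
  shows "(\<lambda>n. potential \<theta> F (x n)) \<longlonglongrightarrow> potential \<theta> F x0"
proof (rule tendsto_sandwich)
  let ?U = "potential \<theta> F x0"
  show "\<forall>\<^sub>F n in sequentially. ennreal (exp (- (\<theta> * \<bar>x0 - x n\<bar>))) * ?U \<le> potential \<theta> F (x n)"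
  proof (intro always_eventually allI)
    fix n
    have "ennreal (exp (- (\<theta> * \<bar>x0 - x n\<bar>))) * ?U
      \<le> ennreal (exp (- (\<theta> * \<bar>x0 - x n\<bar>))) * (ennreal (exp (\<theta> * \<bar>x0 - x n\<bar>)) * potential \<theta> F (x n))"
      by (intro mult_left_mono potential_le_exp_dist \<theta> F) auto
    also have "\<dots> = potential \<theta> F (x n)"
      by (simp add: mult.assoc[symmetric] ennreal_mult[symmetric] exp_add[symmetric])
    finally show "ennreal (exp (- (\<theta> * \<bar>x0 - x n\<bar>))) * ?U \<le> potential \<theta> F (x n)" .
  qed
  show "\<forall>\<^sub>F n in sequentially. potential \<theta> F (x n) \<le> ennreal (exp (\<theta> * \<bar>x n - x0\<bar>)) * ?U"
    by (intro always_eventually allI potential_le_exp_dist \<theta> F)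
  have U: "?U < top"
    using potential_le[OF \<theta> F le, of x0] by (rule order.strict_trans1) simp
  have *: "(\<lambda>n. ennreal (a n) * ?U) \<longlonglongrightarrow> ?U" if "a \<longlonglongrightarrow> 1" for a
    using ennreal_tendsto_cmult[OF U tendsto_ennrealI[OF that]] by (simp add: mult.commute)
  have "(\<lambda>n. exp (- (\<theta> * \<bar>x0 - x n\<bar>))) \<longlonglongrightarrow> exp (- (\<theta> * \<bar>x0 - x0\<bar>))"
    "(\<lambda>n. exp (\<theta> * \<bar>x n - x0\<bar>)) \<longlonglongrightarrow> exp (\<theta> * \<bar>x0 - x0\<bar>)"
    by (intro tendsto_intros x)+
  then show "(\<lambda>n. ennreal (exp (- (\<theta> * \<bar>x0 - x n\<bar>))) * ?U) \<longlonglongrightarrow> ?U"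
    "(\<lambda>n. ennreal (exp (\<theta> * \<bar>x n - x0\<bar>)) * ?U) \<longlonglongrightarrow> ?U"
    by (auto intro!: *)
qed

section \<open>Brownian motion with everywhere continuous paths\<close>

text \<open>
  Independence is a property of the joint distribution, and that does not see null sets.
\<close>

lemma (in prob_space) indep_vars_cong_AE:
  assumes I: "finite I" and indep: "indep_vars M' X I"
    and Y: "\<And>i. i \<in> I \<Longrightarrow> random_variable (M' i) (Y i)"
    and eq: "\<And>i. i \<in> I \<Longrightarrow> AE \<omega> in M. X i \<omega> = Y i \<omega>"
  shows "indep_vars M' Y I"
proof (cases "I = {}")
  case True
  then show ?thesis by (simp add: indep_vars_def2 indep_sets_def)
next
  case False
  have X: "random_variable (M' i) (X i)" if "i \<in> I" for i
    using indep that by (simp add: indep_vars_def2)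
  have all: "AE \<omega> in M. \<forall>i\<in>I. X i \<omega> = Y i \<omega>"
    using I eq by (simp add: AE_finite_all)
  have "distr M (PiM I M') (\<lambda>\<omega>. \<lambda>i\<in>I. Y i \<omega>) = distr M (PiM I M') (\<lambda>\<omega>. \<lambda>i\<in>I. X i \<omega>)"
    using all X Y by (intro distr_cong_AE measurable_restrict) (auto simp: fun_eq_iff restrict_def elim!: eventually_mono)
  also have "\<dots> = PiM I (\<lambda>i. distr M (M' i) (X i))"
    using indep False X by (subst (asm) indep_vars_iff_distr_eq_PiM') auto
  also have "\<dots> = PiM I (\<lambda>i. distr M (M' i) (Y i))"
    using X Y eq by (intro PiM_cong distr_cong_AE) auto
  finally show ?thesis
    using False Y by (subst indep_vars_iff_distr_eq_PiM') auto
qed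

text \<open>
  Setting \<open>X t = 0\<close> for negative \<open>t\<close> makes the paths continuous on the whole line and \<open>X t\<close> measurable for
  every real \<open>t\<close>, which keeps joint measurability and limits along real times simple.
\<close>

locale continuous_brownian_motion = standard_brownian_motion M X
  for M :: "'a measure" and X :: "real \<Rightarrow> 'a \<Rightarrow> real" +
  assumes nonpos: "t \<le> 0 \<Longrightarrow> X t \<omega> = 0"
    and continuous: "continuous_on {0..} (\<lambda>t. X t \<omega>)"

text \<open>
  Paths that are discontinuous or do not start at \<open>0\<close> lie in a null set and are replaced by the zero path.
  The null set is the same for all times, so the modification is indistinguishable from \<open>B\<close>: hitting times
  and path integrals agree almost surely.
\<close>

lemma (in standard_brownian_motion) continuous_modification:
  obtains X where "continuous_brownian_motion M X"
    and "AE \<omega> in M. \<forall>t\<ge>0. X t \<omega> = B t \<omega>"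
proof -
  \<comment> \<open>one null set \<open>N\<close> for both defects of a path\<close>
  have "AE \<omega> in M. B 0 \<omega> = 0 \<and> continuous_on {0..} (\<lambda>t. B t \<omega>)"
    using start_zero continuous_paths by eventually_elim simp
  then obtain N where N: "{\<omega>\<in>space M. \<not> (B 0 \<omega> = 0 \<and> continuous_on {0..} (\<lambda>t. B t \<omega>))} \<subseteq> N"
      "emeasure M N = 0" "N \<in> sets M"
    by (rule AE_E)
  define X where "X t \<omega> = (if t \<le> 0 \<or> \<omega> \<notin> space M - N then 0 else B t \<omega>)" for t \<omega>
  have N_null: "N \<in> null_sets M" using N by auto
  have XB: "AE \<omega> in M. \<forall>t\<ge>0. X t \<omega> = B t \<omega>"
    using AE_not_in[OF N_null] by (rule AE_mp, intro AE_I2 impI) (use N(1) in \<open>auto simp: X_def\<close>)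
  have X_meas: "X t \<in> borel_measurable M" for t
  proof (cases "t \<le> 0")
    case False
    have [measurable]: "N \<in> sets M" "B t \<in> borel_measurable M" using N measurable_B False by auto
    have "(\<lambda>\<omega>. if \<omega> \<in> space M - N then B t \<omega> else 0) \<in> borel_measurable M" by measurable
    then show ?thesis using False by (simp add: X_def[abs_def] if_distrib cong: if_cong)
  qed (simp add: X_def[abs_def])
  have "continuous_brownian_motion M X"
  proof
    show "X t \<in> borel_measurable M" for t by fact
    show "X t \<omega> = 0" if "t \<le> 0" for t \<omega> using that by (simp add: X_def)
    then show "AE \<omega> in M. X 0 \<omega> = 0" by simp
    show cont: "continuous_on {0..} (\<lambda>t. X t \<omega>)" for \<omega>
    proof (cases "\<omega> \<in> space M - N")
      case True
      then have "B 0 \<omega> = 0" "continuous_on {0..} (\<lambda>t. B t \<omega>)" using N(1) by auto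
      moreover have "X t \<omega> = B t \<omega>" if "t \<in> {0..}" for t
        using that True \<open>B 0 \<omega> = 0\<close> by (cases "t = 0") (auto simp: X_def)
      ultimately show ?thesis
        using continuous_on_cong[of "{0..}" "{0..}" "\<lambda>t. X t \<omega>" "\<lambda>t. B t \<omega>"] by blast
    next
      case False
      then show ?thesis by (simp add: X_def[abs_def])
    qed
    then show "AE \<omega> in M. continuous_on {0..} (\<lambda>t. X t \<omega>)" by simp
    show "indep_vars (\<lambda>_. borel) (\<lambda>i \<omega>. X (t (Suc i)) \<omega> - X (t i) \<omega>) {..<n}"
      if t: "0 \<le> t 0" "\<And>i. i < n \<Longrightarrow> t i < t (Suc i)" for n :: nat and t :: "nat \<Rightarrow> real"
    proof (rule indep_vars_cong_AE)
      show "indep_vars (\<lambda>_. borel) (\<lambda>i \<omega>. B (t (Suc i)) \<omega> - B (t i) \<omega>) {..<n}"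
        using t by (rule indep_increments)
      have t_nonneg: "0 \<le> t i" if "i \<le> n" for i
        using that by (induction i) (use t in \<open>auto intro: order_trans less_imp_le simp: Suc_le_eq\<close>)
      show "AE \<omega> in M. B (t (Suc i)) \<omega> - B (t i) \<omega> = X (t (Suc i)) \<omega> - X (t i) \<omega>" if "i \<in> {..<n}" for i
        using XB by (rule eventually_mono) (use that t_nonneg[of i] t_nonneg[of "Suc i"] in auto)
    qed (use X_meas in auto)
    show "distributed M lborel (\<lambda>\<omega>. X t \<omega> - X s \<omega>) (normal_density 0 (sqrt (t - s)))"
      if st: "0 \<le> s" "s < t" for s t
    proof -
      have D: "distributed M lborel (\<lambda>\<omega>. B t \<omega> - B s \<omega>) (normal_density 0 (sqrt (t - s)))"
        using st by (rule gaussian_increments)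
      have "distr M lborel (\<lambda>\<omega>. X t \<omega> - X s \<omega>) = distr M lborel (\<lambda>\<omega>. B t \<omega> - B s \<omega>)"
      proof (intro distr_cong_AE refl)
        show "AE \<omega> in M. X t \<omega> - X s \<omega> = B t \<omega> - B s \<omega>"
          using XB by (rule eventually_mono) (use st in auto)
      qed (use X_meas measurable_B st in auto)
      then show ?thesis
        using D X_meas by (simp add: distributed_def)
    qed
  qed
  then show thesis using XB by (rule that)
qed

context continuous_brownian_motion
begin

lemma measurable_X [measurable]: "X t \<in> borel_measurable M"
proof (cases "0 \<le> t")
  case False
  then have "X t = (\<lambda>_. 0)" by (auto simp: nonpos)
  then show ?thesis by simp
qed (rule measurable_B)

lemma continuous_on_path: "continuous_on S (\<lambda>t. X t \<omega>)"
proof -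
  have "continuous_on ({..0} \<union> {0..}) (\<lambda>t. X t \<omega>)"
    using continuous_on_cong[of "{..0}" "{..0}" "\<lambda>t. X t \<omega>" "\<lambda>_. 0"]
    by (intro continuous_on_closed_Un continuous) (auto simp: nonpos)
  then show ?thesis by (rule continuous_on_subset) auto
qed

text \<open>
  Path continuity gives joint measurability: \<open>X\<close> is the pointwise limit of its values at the grid times
  \<open>\<lfloor>t n\<rfloor> / n\<close>, which are countable in number for each \<open>n\<close>.
\<close>

lemma measurable_X_pair [measurable]:
  "(\<lambda>(t, \<omega>). X t \<omega>) \<in> borel_measurable (borel \<Otimes>\<^sub>M M)"
proof (rule borel_measurable_LIMSEQ_real)
  fix p :: "real \<times> 'a"
  have "(\<lambda>n. X (of_int \<lfloor>fst p * real (Suc n)\<rfloor> / Suc n) (snd p)) \<longlonglongrightarrow> X (fst p) (snd p)"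
  proof (rule continuous_on_tendsto_compose[OF continuous_on_path[of UNIV "snd p"]])
    show "(\<lambda>n. of_int \<lfloor>fst p * real (Suc n)\<rfloor> / real (Suc n)) \<longlonglongrightarrow> fst p"
    proof (rule tendsto_sandwich)
      show "\<forall>\<^sub>F n in sequentially. fst p - 1 / Suc n \<le> of_int \<lfloor>fst p * real (Suc n)\<rfloor> / real (Suc n)"
      proof (intro always_eventually allI)
        fix n
        have "fst p - 1 / Suc n = (fst p * real (Suc n) - 1) / Suc n"
          by (simp add: diff_divide_distrib)
        also have "\<dots> \<le> of_int \<lfloor>fst p * real (Suc n)\<rfloor> / real (Suc n)"
          by (intro divide_right_mono) linarith+
        finally show "fst p - 1 / Suc n \<le> of_int \<lfloor>fst p * real (Suc n)\<rfloor> / real (Suc n)" .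
      qed
      show "\<forall>\<^sub>F n in sequentially. of_int \<lfloor>fst p * real (Suc n)\<rfloor> / real (Suc n) \<le> fst p"
        by (intro always_eventually allI) (simp add: divide_le_eq)
      show "(\<lambda>n. fst p - 1 / Suc n) \<longlonglongrightarrow> fst p"
        using tendsto_diff[OF tendsto_const LIMSEQ_inverse_real_of_nat] by (simp add: inverse_eq_divide)
    qed simp
  qed auto
  then show "(\<lambda>n. case p of (t, \<omega>) \<Rightarrow> X (of_int \<lfloor>t * real (Suc n)\<rfloor> / Suc n) \<omega>) \<longlonglongrightarrow> (case p of (t, \<omega>) \<Rightarrow> X t \<omega>)"
    by (simp add: case_prod_beta)
next
  fix n
  have "(\<lambda>p. X (of_int \<lfloor>fst p * real (Suc n)\<rfloor> / Suc n) (snd p)) \<in> borel_measurable (borel \<Otimes>\<^sub>M M)"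
  proof (rule measurable_compose_countable[where f = "\<lambda>k p. X (of_int k / Suc n) (snd p)" and g = "\<lambda>p. \<lfloor>fst p * real (Suc n)\<rfloor>"])
    show "(\<lambda>p. X (of_int k / Suc n) (snd p)) \<in> borel_measurable (borel \<Otimes>\<^sub>M M)" for k
      by (rule measurable_compose[OF measurable_snd measurable_X])
    show "(\<lambda>p. \<lfloor>fst p * real (Suc n)\<rfloor>) \<in> borel \<Otimes>\<^sub>M M \<rightarrow>\<^sub>M count_space UNIV"
      by measurable
  qed
  then show "(\<lambda>(t, \<omega>). X (of_int \<lfloor>t * real (Suc n)\<rfloor> / Suc n) \<omega>) \<in> borel_measurable (borel \<Otimes>\<^sub>M M)"
    by (simp add: case_prod_beta)
qed

lemma measurable_X_compose [measurable (raw)]: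
  assumes [measurable]: "f \<in> borel_measurable N" "g \<in> measurable N M"
  shows "(\<lambda>w. X (f w) (g w)) \<in> borel_measurable N"
proof -
  have "(\<lambda>w. case (f w, g w) of (t, \<omega>) \<Rightarrow> X t \<omega>) \<in> borel_measurable N"
    by (rule measurable_compose[OF _ measurable_X_pair]) measurable
  then show ?thesis by simp
qed

end

section \<open>The Markov property at a fixed time\<close>

context continuous_brownian_motion
begin

definition past :: "real \<Rightarrow> 'a measure" where
  "past t = sigma (space M) {X u -` C \<inter> space M | u C. 0 \<le> u \<and> u \<le> t \<and> C \<in> sets borel}"

lemma space_past [simp]: "space (past t) = space M"
  unfolding past_def by (rule space_measure_of) auto

lemma sets_past: "sets (past t) = sigma_sets (space M) {X u -` C \<inter> space M | u C. 0 \<le> u \<and> u \<le> t \<and> C \<in> sets borel}"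
  unfolding past_def by (rule sets_measure_of) auto

lemma sets_past_subset: "sets (past t) \<subseteq> sets M"
  unfolding sets_past by (intro sets.sigma_sets_subset) (auto intro: measurable_sets)

lemma past_mono: "s \<le> t \<Longrightarrow> sets (past s) \<subseteq> sets (past t)"
  unfolding sets_past by (intro sigma_sets_mono') fastforce

lemma measurable_X_past: "0 \<le> u \<Longrightarrow> u \<le> t \<Longrightarrow> X u \<in> borel_measurable (past t)"
  by (rule measurableI) (auto simp: sets_past intro!: sigma_sets.Basic)

text \<open>
  The values at finitely many times up to \<open>t\<close> are partial sums of the increments over the sorted
  list of these times. Adding \<open>0\<close> and \<open>t\<close> to the list makes the sums start from \<open>X 0 = 0\<close> and lets the
  increment from \<open>t\<close> to \<open>r\<close> be the next one, so independence of disjoint blocks of increments applies.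
\<close>

lemma increment_indep_finite:
  assumes J: "finite J" "J \<subseteq> {0..t}" and tr: "0 \<le> t" "t < r"
    and C: "\<And>u. u \<in> J \<Longrightarrow> C u \<in> sets borel" and D: "D \<in> sets borel"
  shows "prob ({\<omega>\<in>space M. \<forall>u\<in>J. X u \<omega> \<in> C u} \<inter> ((\<lambda>\<omega>. X r \<omega> - X t \<omega>) -` D \<inter> space M))
    = prob {\<omega>\<in>space M. \<forall>u\<in>J. X u \<omega> \<in> C u} * prob ((\<lambda>\<omega>. X r \<omega> - X t \<omega>) -` D \<inter> space M)"
proof -
  define ts where "ts = sorted_list_of_set (insert 0 (insert t J))"
  define n where "n = length ts - 1"
  \<comment> \<open>the sorted times, followed by \<open>r\<close> at position \<open>n + 1\<close>\<close>
  define \<tau> where "\<tau> i = (if i \<le> n then ts ! i else r)" for i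
  define W where "W i \<omega> = X (\<tau> (Suc i)) \<omega> - X (\<tau> i) \<omega>" for i \<omega>
  have set_ts: "set ts = insert 0 (insert t J)"
    unfolding ts_def by (rule set_sorted_list_of_set) (use J in simp)
  then have len: "length ts = Suc n" unfolding n_def by (cases ts) auto
  have less: "ts ! i < ts ! j" if "i < j" "j \<le> n" for i j
    using that len by (intro sorted_wrt_nth_less[of "(<)"]) (auto simp: ts_def)
  have mem: "ts ! i \<in> {0..t}" if "i \<le> n" for i
    using nth_mem[of i ts] that J tr unfolding set_ts len by auto
  have idx: "\<exists>i\<le>n. ts ! i = u" if "u \<in> insert 0 (insert t J)" for u
    using that unfolding set_ts[symmetric] in_set_conv_nth len by (auto simp: less_Suc_eq_le)
  have ts_0: "ts ! 0 = 0"
    using idx[of 0] less[of 0] mem[of 0] by (metis atLeastAtMost_iff insertI1 less_le_not_le neq0_conv zero_le)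
  have ts_n: "ts ! n = t"
    using idx[of t] less[of _ n] mem[of n]
    by (metis atLeastAtMost_iff insertI1 insertI2 le_neq_implies_less leD order_refl)
  have indep: "indep_vars (\<lambda>_. borel) W {..<Suc n}"
    unfolding W_def
  proof (rule indep_increments)
    show "0 \<le> \<tau> 0" by (simp add: \<tau>_def ts_0)
    show "\<tau> i < \<tau> (Suc i)" if "i < Suc n" for i
      using that less[of i "Suc i"] tr by (cases "i = n") (auto simp: \<tau>_def ts_n)
  qed
  have X_ts: "X (ts ! i) \<omega> = (\<Sum>j<i. W j \<omega>)" if "i \<le> n" for i \<omega>
    using that nonpos[of 0] by (simp add: W_def sum_lessThan_telescope[of "\<lambda>j. X (\<tau> j) \<omega>"]) (simp add: \<tau>_def ts_0)
  have "\<forall>u\<in>J. \<exists>i. i \<le> n \<and> ts ! i = u" using idx by auto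
  then obtain k where k: "\<And>u. u \<in> J \<Longrightarrow> k u \<le> n \<and> ts ! k u = u" by metis
  define S where "S = {w \<in> space (PiM {..<n} (\<lambda>_. borel)). \<forall>u\<in>J. (\<Sum>j<k u. w j) \<in> C u}"
  define S' where "S' = {w \<in> space (PiM {n} (\<lambda>_. borel :: real measure)). w n \<in> D}"
  let ?V = "\<lambda>\<omega>. \<lambda>i\<in>{..<n}. W i \<omega>" and ?V' = "\<lambda>\<omega>. \<lambda>i\<in>{n}. W i \<omega>"
  have ind: "indep_var (PiM {..<n} (\<lambda>_. borel)) ?V (PiM {n} (\<lambda>_. borel)) ?V'"
    by (rule indep_var_restrict[OF indep]) auto
  have S: "S \<in> sets (PiM {..<n} (\<lambda>_. borel))"
    unfolding S_def
  proof (intro sets.sets_Collect_finite_All J)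
    fix u assume u: "u \<in> J"
    have [measurable]: "C u \<in> sets borel" using C u .
    have "(\<lambda>w. \<Sum>j<k u. w j) \<in> borel_measurable (PiM {..<n} (\<lambda>_. borel :: real measure))"
      using k[OF u] by (intro borel_measurable_sum measurable_component_singleton) auto
    then show "{w \<in> space (PiM {..<n} (\<lambda>_. borel)). (\<Sum>j<k u. w j) \<in> C u} \<in> sets (PiM {..<n} (\<lambda>_. borel))"
      by measurable
  qed
  have [measurable]: "D \<in> sets borel" by fact
  have S': "S' \<in> sets (PiM {n} (\<lambda>_. borel))"
    unfolding S'_def by measurable
  have pre: "?V -` S \<inter> space M = {\<omega>\<in>space M. \<forall>u\<in>J. X u \<omega> \<in> C u}"
  proof -
    have "(\<Sum>j<k u. ?V \<omega> j) = X u \<omega>" if "u \<in> J" for u \<omega>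
      using k[OF that] X_ts[of "k u" \<omega>] by (auto intro!: sum.cong)
    then show ?thesis by (auto simp: S_def space_PiM)
  qed
  have pre': "?V' -` S' \<inter> space M = (\<lambda>\<omega>. X r \<omega> - X t \<omega>) -` D \<inter> space M"
    by (auto simp: S'_def space_PiM W_def \<tau>_def ts_n)
  have "prob ((\<lambda>\<omega>. (?V \<omega>, ?V' \<omega>)) -` (S \<times> S') \<inter> space M) = prob (?V -` S \<inter> space M) * prob (?V' -` S' \<inter> space M)"
    by (rule indep_varD[OF ind S S'])
  also have "(\<lambda>\<omega>. (?V \<omega>, ?V' \<omega>)) -` (S \<times> S') \<inter> space M = (?V -` S \<inter> space M) \<inter> (?V' -` S' \<inter> space M)"
    by auto
  finally show ?thesis unfolding pre pre' .
qed

text \<open>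
  The events of the previous lemma form a generator of the past that is closed under intersection.
\<close>

lemma increment_indep_past:
  assumes tr: "0 \<le> t" "t < r" and A: "A \<in> sets (past t)" and E: "E \<in> sets borel"
  shows "prob (A \<inter> ((\<lambda>\<omega>. X r \<omega> - X t \<omega>) -` E \<inter> space M))
    = prob A * prob ((\<lambda>\<omega>. X r \<omega> - X t \<omega>) -` E \<inter> space M)"
proof -
  define D where "D = (\<lambda>\<omega>. X r \<omega> - X t \<omega>)"
  define G where "G = {{\<omega>\<in>space M. \<forall>u\<in>J. X u \<omega> \<in> C u} | J C. finite J \<and> J \<subseteq> {0..t} \<and> (\<forall>u\<in>J. C u \<in> sets borel)}"
  define H where "H = {D -` E \<inter> space M | E. E \<in> sets borel}"
  have D[measurable]: "D \<in> borel_measurable M" unfolding D_def by measurable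
  have G_events: "G \<subseteq> events"
  proof
    fix A assume "A \<in> G"
    then obtain J C where A: "A = {\<omega>\<in>space M. \<forall>u\<in>J. X u \<omega> \<in> C u}" and J: "finite J" "\<And>u. u \<in> J \<Longrightarrow> C u \<in> sets borel"
      unfolding G_def by auto
    show "A \<in> events" unfolding A
    proof (intro sets.sets_Collect_finite_All J)
      fix u assume "u \<in> J"
      then have "X u -` C u \<inter> space M \<in> events" using J by (intro measurable_sets[OF measurable_X]) auto
      then show "{\<omega>\<in>space M. X u \<omega> \<in> C u} \<in> events" by (simp add: vimage_def Int_def conj_commute)
    qed
  qed
  have "indep_set G H"
  proof (rule indep_setI)
    show "prob (a \<inter> b) = prob a * prob b" if ab: "a \<in> G" "b \<in> H" for a b
    proof -
      from ab obtain J C E where "finite J" "J \<subseteq> {0..t}" "\<forall>u\<in>J. C u \<in> sets borel"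
        and a: "a = {\<omega>\<in>space M. \<forall>u\<in>J. X u \<omega> \<in> C u}" and "E \<in> sets borel" and b: "b = D -` E \<inter> space M"
        unfolding G_def H_def by auto
      then show ?thesis
        unfolding a b D_def using tr by (intro increment_indep_finite) auto
    qed
  qed (use G_events in \<open>auto simp: H_def\<close>)
  moreover have "Int_stable G"
  proof (rule Int_stableI)
    fix a b assume "a \<in> G" "b \<in> G"
    then obtain J C J' C' where a: "a = {\<omega>\<in>space M. \<forall>u\<in>J. X u \<omega> \<in> C u}" and b: "b = {\<omega>\<in>space M. \<forall>u\<in>J'. X u \<omega> \<in> C' u}"
      and *: "finite J" "J \<subseteq> {0..t}" "\<forall>u\<in>J. C u \<in> sets borel" "finite J'" "J' \<subseteq> {0..t}" "\<forall>u\<in>J'. C' u \<in> sets borel"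
      unfolding G_def by auto
    let ?C = "\<lambda>u. (if u \<in> J then C u else UNIV) \<inter> (if u \<in> J' then C' u else UNIV)"
    have "a \<inter> b = {\<omega>\<in>space M. \<forall>u\<in>J\<union>J'. X u \<omega> \<in> ?C u}"
      unfolding a b by auto
    moreover have "finite (J \<union> J')" "J \<union> J' \<subseteq> {0..t}" "\<forall>u\<in>J\<union>J'. ?C u \<in> sets borel"
      using * by auto
    ultimately show "a \<inter> b \<in> G" unfolding G_def mem_Collect_eq
      by (intro exI[of _ "J \<union> J'"] exI[of _ ?C] conjI)
  qed
  moreover have "Int_stable H"
  proof (rule Int_stableI)
    fix a b assume "a \<in> H" "b \<in> H"
    then obtain E E' where "a = D -` E \<inter> space M" "b = D -` E' \<inter> space M" "E \<in> sets borel" "E' \<in> sets borel"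
      unfolding H_def by auto
    then show "a \<inter> b \<in> H"
      unfolding H_def mem_Collect_eq by (intro exI[of _ "E \<inter> E'"]) auto
  qed
  ultimately have ind: "indep_set (sigma_sets (space M) G) (sigma_sets (space M) H)"
    by (rule indep_set_sigma_sets)
  have "sets (past t) \<subseteq> sigma_sets (space M) G"
    unfolding sets_past
  proof (rule sigma_sets_mono', safe)
    fix u C assume "0 \<le> u" "u \<le> t" "C \<in> sets (borel :: real measure)"
    then have "finite {u}" "{u} \<subseteq> {0..t}" "\<forall>v\<in>{u}. C \<in> sets borel"
      and "X u -` C \<inter> space M = {\<omega>\<in>space M. \<forall>v\<in>{u}. X v \<omega> \<in> C}" by auto
    then show "X u -` C \<inter> space M \<in> G" unfolding G_def mem_Collect_eq
      by (intro exI[of _ "{u}"] exI[of _ "\<lambda>_. C"] conjI)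
  qed
  then have "A \<in> sigma_sets (space M) G" using A by auto
  moreover have "D -` E \<inter> space M \<in> sigma_sets (space M) H"
    using E by (auto simp: H_def)
  ultimately show ?thesis
    using indep_setD[OF ind] unfolding D_def by blast
qed

text \<open>
  Independence in the form of a product measure, so that Tonelli's theorem can be applied to functions of
  the whole past and the increment.
\<close>

lemma distr_past_increment:
  assumes tr: "0 \<le> t" "t < r"
  shows "distr M (past t \<Otimes>\<^sub>M lborel) (\<lambda>\<omega>. (\<omega>, X r \<omega> - X t \<omega>))
    = distr M (past t) (\<lambda>\<omega>. \<omega>) \<Otimes>\<^sub>M density lborel (normal_density 0 (sqrt (r - t)))"
proof -
  define D where "D \<omega> = X r \<omega> - X t \<omega>" for \<omega>
  have D[measurable]: "D \<in> borel_measurable M" unfolding D_def[abs_def] by measurable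
  have id[measurable]: "(\<lambda>\<omega>. \<omega>) \<in> M \<rightarrow>\<^sub>M past t"
    by (rule measurableI) (use sets_past_subset in \<open>auto dest: sets.sets_into_space simp: Int_absorb2\<close>)
  interpret L: prob_space "distr M (past t) (\<lambda>\<omega>. \<omega>)" by (rule prob_space_distr[OF id])
  interpret R: prob_space "density lborel (normal_density 0 (sqrt (r - t)))"
    using tr by (intro prob_space_normal_density) auto
  have distr_D: "distr M lborel D = density lborel (normal_density 0 (sqrt (r - t)))"
    using gaussian_increments[OF tr] by (simp add: distributed_def D_def[abs_def])
  show ?thesis
    unfolding D_def[symmetric]
  proof (rule sym, rule pair_measure_eqI)
    show "sigma_finite_measure (distr M (past t) (\<lambda>\<omega>. \<omega>))" "sigma_finite_measure (density lborel (normal_density 0 (sqrt (r - t))))"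
      by unfold_locales
    show "sets (distr M (past t) (\<lambda>\<omega>. \<omega>) \<Otimes>\<^sub>M density lborel (normal_density 0 (sqrt (r - t))))
      = sets (distr M (past t \<Otimes>\<^sub>M lborel) (\<lambda>\<omega>. (\<omega>, D \<omega>)))"
      by (simp cong: sets_pair_measure_cong)
  next
    fix A E assume "A \<in> sets (distr M (past t) (\<lambda>\<omega>. \<omega>))" "E \<in> sets (density lborel (normal_density 0 (sqrt (r - t))))"
    then have A[measurable]: "A \<in> sets (past t)" and E[measurable]: "E \<in> sets borel" by auto
    have AM: "A \<in> events" "A \<subseteq> space M"
      using A sets_past_subset[of t] sets.sets_into_space[OF A] by auto
    have "emeasure (distr M (past t \<Otimes>\<^sub>M lborel) (\<lambda>\<omega>. (\<omega>, D \<omega>))) (A \<times> E) = emeasure M (A \<inter> (D -` E \<inter> space M))"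
      using AM by (subst emeasure_distr) (auto intro!: arg_cong[where f="emeasure M"])
    also have "\<dots> = emeasure M A * emeasure M (D -` E \<inter> space M)"
      using increment_indep_past[OF tr A E] unfolding D_def[symmetric]
      by (simp add: emeasure_eq_measure ennreal_mult)
    also have "emeasure M (D -` E \<inter> space M) = emeasure (distr M lborel D) E"
      by (subst emeasure_distr) auto
    also have "emeasure M A = emeasure (distr M (past t) (\<lambda>\<omega>. \<omega>)) A"
      using AM by (subst emeasure_distr) (auto intro!: arg_cong[where f="emeasure M"])
    finally show "emeasure (distr M (past t) (\<lambda>\<omega>. \<omega>)) A * emeasure (density lborel (normal_density 0 (sqrt (r - t)))) E
      = emeasure (distr M (past t \<Otimes>\<^sub>M lborel) (\<lambda>\<omega>. (\<omega>, D \<omega>))) (A \<times> E)"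
      by (simp add: distr_D)
  qed
qed

lemma markov_property:
  assumes tr: "0 \<le> t" "t < r" and A: "A \<in> sets (past t)" and F[measurable]: "F \<in> borel_measurable borel"
  shows "(\<integral>\<^sup>+\<omega>\<in>A. F (X r \<omega>) \<partial>M)
    = (\<integral>\<^sup>+\<omega>\<in>A. (\<integral>\<^sup>+y. ennreal (normal_density 0 (sqrt (r - t)) (y - X t \<omega>)) * F y \<partial>lborel) \<partial>M)"
proof -
  let ?D = "\<lambda>\<omega>. X r \<omega> - X t \<omega>" and ?p = "normal_density 0 (sqrt (r - t))"
  have id[measurable]: "(\<lambda>\<omega>. \<omega>) \<in> M \<rightarrow>\<^sub>M past t"
    by (rule measurableI) (use sets_past_subset in \<open>auto dest: sets.sets_into_space simp: Int_absorb2\<close>)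
  interpret R: prob_space "density lborel ?p"
    using tr by (intro prob_space_normal_density) auto
  have [measurable]: "X t \<in> borel_measurable (past t)" using tr by (intro measurable_X_past) auto
  note A[measurable]
  have "(\<integral>\<^sup>+\<omega>\<in>A. F (X r \<omega>) \<partial>M) = (\<integral>\<^sup>+\<omega>. (\<lambda>(\<omega>, d). F (X t \<omega> + d) * indicator A \<omega>) (\<omega>, ?D \<omega>) \<partial>M)"
    by simp
  also have "\<dots> = (\<integral>\<^sup>+z. (\<lambda>(\<omega>, d). F (X t \<omega> + d) * indicator A \<omega>) z \<partial>distr M (past t \<Otimes>\<^sub>M lborel) (\<lambda>\<omega>. (\<omega>, ?D \<omega>)))"
    by (subst nn_integral_distr) measurable
  also have "\<dots> = (\<integral>\<^sup>+\<omega>. \<integral>\<^sup>+d. F (X t \<omega> + d) * indicator A \<omega> \<partial>density lborel ?p \<partial>distr M (past t) (\<lambda>\<omega>. \<omega>))"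
    unfolding distr_past_increment[OF tr] by (subst R.nn_integral_fst[symmetric]) auto
  also have "\<dots> = (\<integral>\<^sup>+\<omega>. \<integral>\<^sup>+d. F (X t \<omega> + d) * indicator A \<omega> \<partial>density lborel ?p \<partial>M)"
    by (subst nn_integral_distr) measurable
  also have "\<dots> = (\<integral>\<^sup>+\<omega>\<in>A. (\<integral>\<^sup>+y. ennreal (?p (y - X t \<omega>)) * F y \<partial>lborel) \<partial>M)"
  proof (intro nn_integral_cong, goal_cases)
    case (1 \<omega>)
    have "(\<integral>\<^sup>+d. F (X t \<omega> + d) * indicator A \<omega> \<partial>density lborel ?p)
       = (\<integral>\<^sup>+d. ennreal (?p d) * F (X t \<omega> + d) * indicator A \<omega> \<partial>lborel)"
      by (subst nn_integral_density) (auto simp: mult.assoc)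
    also have "\<dots> = (\<integral>\<^sup>+d. ennreal (?p d) * F (X t \<omega> + d) \<partial>lborel) * indicator A \<omega>"
      by (intro nn_integral_multc) measurable
    also have "(\<integral>\<^sup>+d. ennreal (?p d) * F (X t \<omega> + d) \<partial>lborel) = (\<integral>\<^sup>+y. ennreal (?p (y - X t \<omega>)) * F y \<partial>lborel)"
      by (subst (2) nn_integral_real_affine[where c = 1 and t = "X t \<omega>"]) auto
    finally show ?case .
  qed
  finally show ?thesis .
qed

text \<open>
  The Markov property at time \<open>t\<close>, integrated over all later times with weight \<open>exp(-\<theta>\<^sup>2 r/2)\<close>. The
  potential on the right is a continuous function of the position when \<open>F\<close> is bounded; this is what the
  approximation of the hitting time below needs.
\<close>

lemma markov_resolvent:
  assumes \<theta>: "0 < \<theta>" and t: "0 \<le> t" and A: "A \<in> sets (past t)" and F[measurable]: "F \<in> borel_measurable borel"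
  shows "(\<integral>\<^sup>+\<omega>\<in>A. (\<integral>\<^sup>+r\<in>{t<..}. ennreal (exp (- (\<theta>\<^sup>2 / 2 * r))) * F (X r \<omega>) \<partial>lborel) \<partial>M)
    = (\<integral>\<^sup>+\<omega>\<in>A. ennreal (exp (- (\<theta>\<^sup>2 / 2 * t))) * potential \<theta> F (X t \<omega>) \<partial>M)"
proof -
  interpret pair_sigma_finite M lborel ..
  have [measurable]: "A \<in> events" using A sets_past_subset by auto
  let ?e = "\<lambda>r. ennreal (exp (- (\<theta>\<^sup>2 / 2 * r))) * indicator {t<..} r"
  have "(\<integral>\<^sup>+\<omega>\<in>A. (\<integral>\<^sup>+r\<in>{t<..}. ennreal (exp (- (\<theta>\<^sup>2 / 2 * r))) * F (X r \<omega>) \<partial>lborel) \<partial>M)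
    = (\<integral>\<^sup>+\<omega>. \<integral>\<^sup>+r. ?e r * (F (X r \<omega>) * indicator A \<omega>) \<partial>lborel \<partial>M)"
    by (intro nn_integral_cong) (subst nn_integral_multc[symmetric], measurable, auto intro!: nn_integral_cong simp: mult_ac)
  also have "\<dots> = (\<integral>\<^sup>+r. \<integral>\<^sup>+\<omega>. ?e r * (F (X r \<omega>) * indicator A \<omega>) \<partial>M \<partial>lborel)"
    by (rule Fubini'[symmetric]) measurable
  also have "\<dots> = (\<integral>\<^sup>+r. \<integral>\<^sup>+\<omega>. ?e r * ((\<integral>\<^sup>+y. ennreal (normal_density 0 (sqrt (r - t)) (y - X t \<omega>)) * F y \<partial>lborel) * indicator A \<omega>) \<partial>M \<partial>lborel)"
  proof (rule nn_integral_cong)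
    fix r :: real
    show "(\<integral>\<^sup>+\<omega>. ?e r * (F (X r \<omega>) * indicator A \<omega>) \<partial>M) = (\<integral>\<^sup>+\<omega>. ?e r * ((\<integral>\<^sup>+y. ennreal (normal_density 0 (sqrt (r - t)) (y - X t \<omega>)) * F y \<partial>lborel) * indicator A \<omega>) \<partial>M)"
    proof (cases "t < r")
      case True
      show ?thesis
        using markov_property[OF t True A F]
        by (subst (1 2) nn_integral_cmult) auto
    qed simp
  qed
  also have "\<dots> = (\<integral>\<^sup>+\<omega>. \<integral>\<^sup>+r. ?e r * ((\<integral>\<^sup>+y. ennreal (normal_density 0 (sqrt (r - t)) (y - X t \<omega>)) * F y \<partial>lborel) * indicator A \<omega>) \<partial>lborel \<partial>M)"
    by (rule Fubini') measurable
  also have "\<dots> = (\<integral>\<^sup>+\<omega>\<in>A. ennreal (exp (- (\<theta>\<^sup>2 / 2 * t))) * potential \<theta> F (X t \<omega>) \<partial>M)"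
    unfolding Laplace_heat_semigroup[OF \<theta> F, symmetric]
    by (intro nn_integral_cong) (subst nn_integral_multc[symmetric], measurable, auto intro!: nn_integral_cong simp: mult_ac)
  finally show ?thesis .
qed

end

section \<open>The strong Markov property at the hitting time of 1\<close>

context continuous_brownian_motion
begin

definition hits :: "'a \<Rightarrow> bool" where
  "hits \<omega> \<longleftrightarrow> (\<exists>t\<ge>0. X t \<omega> = 1)"

definition \<tau> :: "'a \<Rightarrow> real" where
  "\<tau> \<omega> = real_of_ereal (hitting_time X 1 \<omega>)"

text \<open>
  The event that level \<open>1\<close> is not hit up to time \<open>t\<close> (see \<open>survives_iff\<close>). It is expressed by the path on
  \<open>{0..t}\<close> alone in order to see that it belongs to the past of \<open>t\<close>.
\<close>

definition survives :: "real \<Rightarrow> 'a set" where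
  "survives t = {\<omega>\<in>space M. \<forall>u\<in>{0..t}. X u \<omega> < 1}"

lemma crossing:
  assumes "1 \<le> X u \<omega>"
  obtains v where "0 \<le> v" "v \<le> u" "X v \<omega> = 1"
proof -
  have "0 \<le> u" using assms nonpos[of u \<omega>] by (cases "0 \<le> u") auto
  then have "\<exists>v\<ge>0. v \<le> u \<and> X v \<omega> = 1"
    using assms nonpos[of 0 \<omega>] by (intro IVT' continuous_on_path) auto
  then show thesis using that by blast
qed

lemma hitting_time_attained:
  assumes "hits \<omega>"
  shows "hitting_time X 1 \<omega> = ereal (\<tau> \<omega>)" "0 < \<tau> \<omega>" "X (\<tau> \<omega>) \<omega> = 1"
    and "u < \<tau> \<omega> \<Longrightarrow> X u \<omega> < 1"
proof -
  define S where "S = {t. 0 \<le> t \<and> X t \<omega> = 1}"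
  have "S = {0..} \<inter> (\<lambda>t. X t \<omega>) -` {1}" by (auto simp: S_def)
  then have "closed S"
    using continuous_closed_vimage[OF closed_singleton, of "\<lambda>t. X t \<omega>" 1] continuous_on_path[of UNIV \<omega>]
    by (auto simp: continuous_on_eq_continuous_at intro!: closed_Int)
  moreover have S: "S \<noteq> {}" "bdd_below S"
    using assms by (auto simp: S_def hits_def intro!: bdd_belowI[of _ 0])
  ultimately have inS: "Inf S \<in> S" by (intro closed_contains_Inf)
  have "hitting_time X 1 \<omega> = ereal (Inf S)"
    unfolding hitting_time_def S_def[symmetric]
    by (intro antisym INF_lower INF_greatest inS) (auto intro: cInf_lower S)
  then show h: "hitting_time X 1 \<omega> = ereal (\<tau> \<omega>)" by (simp add: \<tau>_def)
  with \<open>hitting_time X 1 \<omega> = ereal (Inf S)\<close> have \<tau>: "\<tau> \<omega> = Inf S" by simp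
  show "X (\<tau> \<omega>) \<omega> = 1" using inS by (simp add: \<tau> S_def)
  with nonpos[of "\<tau> \<omega>" \<omega>] show "0 < \<tau> \<omega>" by (cases "0 < \<tau> \<omega>") auto
  show "X u \<omega> < 1" if u: "u < \<tau> \<omega>"
  proof (rule ccontr)
    assume "\<not> X u \<omega> < 1"
    then obtain v where "0 \<le> v" "v \<le> u" "X v \<omega> = 1" using crossing[of u \<omega>] by auto
    then have "Inf S \<le> u" using S by (intro cInf_lower2[of v]) (auto simp: S_def)
    with u \<tau> show False by simp
  qed
qed

lemma not_hits:
  assumes "\<not> hits \<omega>"
  shows "hitting_time X 1 \<omega> = \<infinity>" "X u \<omega> < 1"
proof -
  have empty: "{t. 0 \<le> t \<and> X t \<omega> = 1} = {}" using assms by (auto simp: hits_def)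
  show "hitting_time X 1 \<omega> = \<infinity>" unfolding hitting_time_def empty by (simp add: top_ereal_def)
  show "X u \<omega> < 1"
    using assms crossing[of u \<omega>] by (auto simp: hits_def not_less[symmetric])
qed

lemma survives_iff:
  assumes "0 \<le> t" "\<omega> \<in> space M"
  shows "\<omega> \<in> survives t \<longleftrightarrow> (hits \<omega> \<longrightarrow> t < \<tau> \<omega>)"
proof (cases "hits \<omega>")
  case True
  note T = hitting_time_attained[OF True]
  have "t < \<tau> \<omega>" if "\<omega> \<in> survives t"
  proof (rule ccontr)
    assume "\<not> t < \<tau> \<omega>"
    then have "X (\<tau> \<omega>) \<omega> < 1" using that T(2) by (auto simp: survives_def)
    then show False using T(3) by simp
  qed
  then show ?thesis using assms True T(4) by (auto simp: survives_def)
next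
  case False
  then show ?thesis using assms not_hits by (auto simp: survives_def)
qed

text \<open>
  A continuous path attains its maximum on \<open>{0..t}\<close>, so it stays below \<open>1\<close> iff it stays below
  \<open>1 - 1/(k+1)\<close> for some \<open>k\<close>; the latter, a closed condition, can be tested at rational times.
\<close>

lemma sets_survives:
  assumes t: "0 \<le> t"
  shows "survives t \<in> sets (past t)"
proof (cases "t = 0")
  case True
  then have "survives t = space (past t)" by (auto simp: survives_def nonpos)
  then show ?thesis by (metis sets.top)
next
  case False
  define Q where "Q = {0<..<t} \<inter> \<rat>"
  have cl: "{0..t} \<subseteq> closure Q"
  proof -
    have "{0<..<t} \<subseteq> closure Q"
      using open_Int_closure_subset[of "{0<..<t}" \<rat>] by (simp add: Q_def Rats_closure_real)
    then have "closure {0<..<t} \<subseteq> closure Q" by (rule closure_minimal) simp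
    then show ?thesis using False t by simp
  qed
  have "survives t = {\<omega>\<in>space (past t). \<exists>k::nat. \<forall>q\<in>Q. X q \<omega> \<le> 1 - 1 / Suc k}"
  proof (intro set_eqI iffI)
    fix \<omega> assume "\<omega> \<in> survives t"
    then have \<omega>: "\<omega> \<in> space M" "\<And>u. u \<in> {0..t} \<Longrightarrow> X u \<omega> < 1" by (auto simp: survives_def)
    obtain v where v: "v \<in> {0..t}" "\<And>u. u \<in> {0..t} \<Longrightarrow> X u \<omega> \<le> X v \<omega>"
      using continuous_attains_sup[OF compact_Icc _ continuous_on_path[of "{0..t}" \<omega>]] t by auto
    obtain k where k: "inverse (of_nat (Suc k)) < 1 - X v \<omega>"
      using \<omega>(2)[OF v(1)] reals_Archimedean[of "1 - X v \<omega>"] by auto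
    have "X q \<omega> \<le> 1 - 1 / Suc k" if "q \<in> Q" for q
      using v(2)[of q] k that by (auto simp: Q_def inverse_eq_divide)
    with \<omega>(1) show "\<omega> \<in> {\<omega>\<in>space (past t). \<exists>k::nat. \<forall>q\<in>Q. X q \<omega> \<le> 1 - 1 / Suc k}" by auto
  next
    fix \<omega> assume "\<omega> \<in> {\<omega>\<in>space (past t). \<exists>k::nat. \<forall>q\<in>Q. X q \<omega> \<le> 1 - 1 / Suc k}"
    then obtain k :: nat where \<omega>: "\<omega> \<in> space M" and k: "\<And>q. q \<in> Q \<Longrightarrow> X q \<omega> \<le> 1 - 1 / Suc k" by auto
    have "X u \<omega> < 1" if "u \<in> {0..t}" for u
    proof -
      have "X u \<omega> \<le> 1 - 1 / Suc k"
        by (rule continuous_le_on_closure[OF continuous_on_path _ k]) (use cl that in blast)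
      also have "\<dots> < 1" by simp
      finally show ?thesis .
    qed
    then show "\<omega> \<in> survives t"
      using \<omega> unfolding survives_def by blast
  qed
  also have "\<dots> \<in> sets (past t)"
  proof -
    have "{\<omega>\<in>space (past t). X q \<omega> \<le> 1 - 1 / Suc k} \<in> sets (past t)" if "q \<in> Q" for q k
    proof -
      have [measurable]: "X q \<in> borel_measurable (past t)"
        using that by (intro measurable_X_past) (auto simp: Q_def)
      show ?thesis by measurable
    qed
    then have "{\<omega>\<in>space (past t). of_rat q \<in> Q \<longrightarrow> X (of_rat q) \<omega> \<le> 1 - 1 / Suc k} \<in> sets (past t)" for q k
      by (cases "of_rat q \<in> Q") (auto intro: sets.top[of "past t", simplified])
    then have "{\<omega>\<in>space (past t). \<exists>k::nat. \<forall>q. of_rat q \<in> Q \<longrightarrow> X (of_rat q) \<omega> \<le> 1 - 1 / Suc k} \<in> sets (past t)"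
      by (intro sets.sets_Collect_countable_Ex sets.sets_Collect_countable_All)
    moreover have "(\<forall>q\<in>Q. P q) \<longleftrightarrow> (\<forall>q. of_rat q \<in> Q \<longrightarrow> P (of_rat q))" for P :: "real \<Rightarrow> bool"
      by (auto simp: Q_def elim!: Rats_cases)
    ultimately show ?thesis by simp
  qed
  finally show ?thesis .
qed

lemma measurable_hitting_time [measurable]: "(\<lambda>\<omega>. hitting_time X 1 \<omega>) \<in> borel_measurable M"
proof (rule borel_measurableI_greater)
  fix y :: ereal
  have nonneg: "0 < hitting_time X 1 \<omega>" for \<omega>
    using not_hits(1)[of \<omega>] hitting_time_attained(1,2)[of \<omega>] by (cases "hits \<omega>") auto
  show "{\<omega>\<in>space M. y < hitting_time X 1 \<omega>} \<in> events"
  proof (cases "0 \<le> y")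
    case True
    show ?thesis
    proof (cases y)
      case (real t)
      have "{\<omega>\<in>space M. y < hitting_time X 1 \<omega>} = survives t"
      proof (intro set_eqI)
        fix \<omega>
        show "\<omega> \<in> {\<omega>\<in>space M. y < hitting_time X 1 \<omega>} \<longleftrightarrow> \<omega> \<in> survives t"
        proof (cases "\<omega> \<in> space M")
          case \<omega>: True
          show ?thesis
            using True real \<omega> survives_iff[of t \<omega>] not_hits(1)[of \<omega>] hitting_time_attained(1)[of \<omega>]
            by (cases "hits \<omega>") auto
        qed (simp add: survives_def)
      qed
      then show ?thesis using sets_survives[of t] sets_past_subset[of t] True real by auto
    qed (use True in auto)
  next
    case False
    then have "{\<omega>\<in>space M. y < hitting_time X 1 \<omega>} = space M"
      using nonneg by (auto simp: not_le intro: less_trans)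
    then show ?thesis by simp
  qed
qed

lemma measurable_\<tau> [measurable]: "\<tau> \<in> borel_measurable M"
  unfolding \<tau>_def[abs_def] by measurable

lemma hits_iff: "hits \<omega> \<longleftrightarrow> hitting_time X 1 \<omega> < \<infinity>"
  using not_hits(1) hitting_time_attained(1) by (cases "hits \<omega>") auto

lemma measurable_hits [measurable]: "Measurable.pred M hits"
  unfolding hits_iff[abs_def] by measurable

text \<open>X\<close>
text \<open>
  The strong Markov property at \<open>T\<close>, the first time of the grid \<open>s + \<delta>\<nat>\<close> that is not before \<open>\<tau>\<close>. The
  event \<open>T = s + (k+1)\<delta>\<close> says that \<open>1\<close> is first hit in a given interval that ends at \<open>s + (k+1)\<delta>\<close>, hence it belongs
  to the past of that time; the Markov property at each grid time can be summed over \<open>k\<close>.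
\<close>

lemma strong_markov_grid:
  fixes s \<delta> :: real
  defines "T \<omega> \<equiv> s + \<delta> * of_int \<lceil>(\<tau> \<omega> - s) / \<delta>\<rceil>"
  assumes \<theta>: "0 < \<theta>" and s: "0 \<le> s" and \<delta>: "0 < \<delta>" and A: "A \<in> sets (past s)"
    and F[measurable]: "F \<in> borel_measurable borel"
  shows "(\<integral>\<^sup>+\<omega>\<in>A \<inter> {\<omega>\<in>space M. hits \<omega> \<and> s < \<tau> \<omega>}.
            (\<integral>\<^sup>+r\<in>{T \<omega><..}. ennreal (exp (- (\<theta>\<^sup>2 / 2 * r))) * F (X r \<omega>) \<partial>lborel) \<partial>M)
    = (\<integral>\<^sup>+\<omega>\<in>A \<inter> {\<omega>\<in>space M. hits \<omega> \<and> s < \<tau> \<omega>}.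
            ennreal (exp (- (\<theta>\<^sup>2 / 2 * T \<omega>))) * potential \<theta> F (X (T \<omega>) \<omega>) \<partial>M)"
proof -
  define t where "t k = s + real k * \<delta>" for k
  \<comment> \<open>on \<open>C k\<close> the level is first hit during the half-open interval from \<open>t k\<close> to \<open>t (Suc k)\<close>\<close>
  define C where "C k = A \<inter> (survives (t k) - survives (t (Suc k)))" for k
  have t_nonneg: "0 \<le> t k" for k using s \<delta> by (simp add: t_def)
  have t_mono: "t k \<le> t (Suc k)" and s_le: "s \<le> t k" for k using \<delta> by (auto simp: t_def algebra_simps)
  have AM: "A \<subseteq> space M" "A \<in> events"
    using A sets_past_subset[of s] sets.sets_into_space[OF A] by auto
  have C_iff: "\<omega> \<in> C k \<longleftrightarrow> \<omega> \<in> A \<and> hits \<omega> \<and> t k < \<tau> \<omega> \<and> \<tau> \<omega> \<le> t (Suc k)" for \<omega> k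
    using AM(1) survives_iff[OF t_nonneg] by (auto simp: C_def not_less)
  have C_past: "C k \<in> sets (past (t (Suc k)))" for k
  proof -
    have "A \<in> sets (past (t (Suc k)))" "survives (t k) \<in> sets (past (t (Suc k)))"
      using A sets_survives[OF t_nonneg, of k] past_mono[OF s_le, of "Suc k"] past_mono[OF t_mono, of k] by auto
    then show ?thesis using sets_survives[OF t_nonneg, of "Suc k"] unfolding C_def by auto
  qed
  then have C_events[measurable]: "C k \<in> events" for k using sets_past_subset by blast
  have T_C: "T \<omega> = t (Suc k)" if "\<omega> \<in> C k" for \<omega> k
  proof -
    have "real k < (\<tau> \<omega> - s) / \<delta>" "(\<tau> \<omega> - s) / \<delta> \<le> real k + 1"
      using that \<delta> by (auto simp: C_iff t_def field_simps)
    then have "\<lceil>(\<tau> \<omega> - s) / \<delta>\<rceil> = int (Suc k)" by (intro ceiling_unique) auto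
    then show ?thesis by (simp add: T_def t_def)
  qed
  have UN_C: "(\<Union>k. C k) = A \<inter> {\<omega>\<in>space M. hits \<omega> \<and> s < \<tau> \<omega>}"
  proof (intro set_eqI iffI)
    fix \<omega> assume "\<omega> \<in> (\<Union>k. C k)"
    then show "\<omega> \<in> A \<inter> {\<omega>\<in>space M. hits \<omega> \<and> s < \<tau> \<omega>}"
      using s_le AM(1) by (auto simp: C_iff intro: order.strict_trans1)
  next
    fix \<omega> assume \<omega>: "\<omega> \<in> A \<inter> {\<omega>\<in>space M. hits \<omega> \<and> s < \<tau> \<omega>}"
    define k where "k = nat (\<lceil>(\<tau> \<omega> - s) / \<delta>\<rceil> - 1)"
    have pos: "0 < (\<tau> \<omega> - s) / \<delta>" using \<omega> \<delta> by auto
    then have "real k = of_int \<lceil>(\<tau> \<omega> - s) / \<delta>\<rceil> - 1" by (simp add: k_def)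
    then have "real k < (\<tau> \<omega> - s) / \<delta>" "(\<tau> \<omega> - s) / \<delta> \<le> real k + 1" by linarith+
    then have "\<omega> \<in> C k" using \<omega> \<delta> by (auto simp: C_iff t_def field_simps)
    then show "\<omega> \<in> (\<Union>k. C k)" by blast
  qed
  have disj: "disjoint_family C"
  proof -
    have "C i \<inter> C j = {}" if "i \<noteq> j" for i j
    proof (rule ccontr)
      assume "C i \<inter> C j \<noteq> {}"
      then obtain \<omega> where "\<omega> \<in> C i" "\<omega> \<in> C j" by auto
      then have "t (Suc i) = t (Suc j)" using T_C by metis
      then show False using that \<delta> by (simp add: t_def)
    qed
    then show ?thesis by (auto simp: disjoint_family_on_def)
  qed
  have T_meas[measurable]: "T \<in> borel_measurable M" unfolding T_def by measurable
  let ?J = "\<lambda>v \<omega>. \<integral>\<^sup>+r\<in>{v<..}. ennreal (exp (- (\<theta>\<^sup>2 / 2 * r))) * F (X r \<omega>) \<partial>lborel"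
  let ?R = "\<lambda>v \<omega>. ennreal (exp (- (\<theta>\<^sup>2 / 2 * v))) * potential \<theta> F (X v \<omega>)"
  have J_meas: "(\<lambda>\<omega>. ?J (T \<omega>) \<omega>) \<in> borel_measurable M"
    unfolding greaterThan_iff indicator_def of_bool_def by measurable
  have R_meas: "(\<lambda>\<omega>. ?R (T \<omega>) \<omega>) \<in> borel_measurable M" by measurable
  have "(\<integral>\<^sup>+\<omega>\<in>(\<Union>k. C k). ?J (T \<omega>) \<omega> \<partial>M) = (\<Sum>k. \<integral>\<^sup>+\<omega>\<in>C k. ?J (T \<omega>) \<omega> \<partial>M)"
    by (rule nn_integral_disjoint_family[OF J_meas C_events disj])
  also have "\<dots> = (\<Sum>k. \<integral>\<^sup>+\<omega>\<in>C k. ?R (T \<omega>) \<omega> \<partial>M)"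
  proof (rule suminf_cong)
    fix k
    have "(\<integral>\<^sup>+\<omega>\<in>C k. ?J (T \<omega>) \<omega> \<partial>M) = (\<integral>\<^sup>+\<omega>\<in>C k. ?J (t (Suc k)) \<omega> \<partial>M)"
      by (intro nn_integral_cong) (auto simp: T_C split: split_indicator)
    also have "\<dots> = (\<integral>\<^sup>+\<omega>\<in>C k. ?R (t (Suc k)) \<omega> \<partial>M)"
      by (rule markov_resolvent[OF \<theta> t_nonneg C_past F])
    also have "\<dots> = (\<integral>\<^sup>+\<omega>\<in>C k. ?R (T \<omega>) \<omega> \<partial>M)"
      by (intro nn_integral_cong) (auto simp: T_C split: split_indicator)
    finally show "(\<integral>\<^sup>+\<omega>\<in>C k. ?J (T \<omega>) \<omega> \<partial>M) = (\<integral>\<^sup>+\<omega>\<in>C k. ?R (T \<omega>) \<omega> \<partial>M)" .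
  qed
  also have "\<dots> = (\<integral>\<^sup>+\<omega>\<in>(\<Union>k. C k). ?R (T \<omega>) \<omega> \<partial>M)"
    by (rule nn_integral_disjoint_family[OF R_meas C_events disj, symmetric])
  finally show ?thesis unfolding UN_C .
qed

text \<open>
  Apply the grid version with mesh \<open>1/(n+1)\<close>. On the right, continuity of the path and of the
  potential give the limit, as \<open>X \<tau> = 1\<close>; boundedness of the potential gives domination. On the left,
  replacing \<open>\<tau>\<close> by the grid time changes the integral by at most the mesh.
\<close>

lemma strong_markov_resolvent:
  assumes \<theta>: "0 < \<theta>" and s: "0 \<le> s" and A: "A \<in> sets (past s)"
    and F[measurable]: "F \<in> borel_measurable borel" and le: "\<And>y. F y \<le> 1"
  shows "(\<integral>\<^sup>+\<omega>\<in>A \<inter> {\<omega>\<in>space M. hits \<omega> \<and> s < \<tau> \<omega>}.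
            (\<integral>\<^sup>+r\<in>{\<tau> \<omega><..}. ennreal (exp (- (\<theta>\<^sup>2 / 2 * r))) * F (X r \<omega>) \<partial>lborel) \<partial>M)
    = potential \<theta> F 1 *
       (\<integral>\<^sup>+\<omega>\<in>A \<inter> {\<omega>\<in>space M. hits \<omega> \<and> s < \<tau> \<omega>}. ennreal (exp (- (\<theta>\<^sup>2 / 2 * \<tau> \<omega>))) \<partial>M)"
    (is "(\<integral>\<^sup>+\<omega>\<in>?A. _ \<partial>M) = _")
proof -
  define T where "T n \<omega> = s + 1 / Suc n * of_int \<lceil>(\<tau> \<omega> - s) / (1 / Suc n)\<rceil>" for n \<omega>
  let ?J = "\<lambda>v \<omega>. \<integral>\<^sup>+r\<in>{v<..}. ennreal (exp (- (\<theta>\<^sup>2 / 2 * r))) * F (X r \<omega>) \<partial>lborel"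
  let ?R = "\<lambda>v \<omega>. ennreal (exp (- (\<theta>\<^sup>2 / 2 * v))) * potential \<theta> F (X v \<omega>)"
  have [measurable]: "A \<in> events" using A sets_past_subset[of s] by auto
  have A_events[measurable]: "?A \<in> events" by measurable
  have [measurable]: "T n \<in> borel_measurable M" for n unfolding T_def[abs_def] by measurable
  have J_meas[measurable]: "(\<lambda>\<omega>. ?J (f \<omega>) \<omega>) \<in> borel_measurable M" if [measurable]: "f \<in> borel_measurable M" for f
    unfolding greaterThan_iff indicator_def of_bool_def by measurable
  have T_bounds: "\<tau> \<omega> \<le> T n \<omega>" "T n \<omega> \<le> \<tau> \<omega> + 1 / Suc n" for n \<omega>
  proof -
    have "\<tau> \<omega> - s = 1 / Suc n * ((\<tau> \<omega> - s) / (1 / Suc n))" by simp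
    also have "\<dots> \<le> 1 / Suc n * of_int \<lceil>(\<tau> \<omega> - s) / (1 / Suc n)\<rceil>" by (intro mult_left_mono) auto
    finally show "\<tau> \<omega> \<le> T n \<omega>" by (simp add: T_def)
    have "1 / Suc n * of_int \<lceil>(\<tau> \<omega> - s) / (1 / Suc n)\<rceil> \<le> 1 / Suc n * ((\<tau> \<omega> - s) / (1 / Suc n) + 1)"
      by (intro mult_left_mono) (auto simp: less_imp_le)
    also have "\<dots> = \<tau> \<omega> - s + 1 / Suc n" by (simp add: distrib_left del: of_nat_Suc)
    finally show "T n \<omega> \<le> \<tau> \<omega> + 1 / Suc n" by (simp add: T_def)
  qed
  have inv_lim: "(\<lambda>n. 1 / real (Suc n)) \<longlonglongrightarrow> 0"
    using LIMSEQ_inverse_real_of_nat by (simp add: inverse_eq_divide)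
  have T_lim: "(\<lambda>n. T n \<omega>) \<longlonglongrightarrow> \<tau> \<omega>" for \<omega>
  proof (rule tendsto_sandwich[OF _ _ tendsto_const])
    show "(\<lambda>n. \<tau> \<omega> + 1 / Suc n) \<longlonglongrightarrow> \<tau> \<omega>" using tendsto_add[OF tendsto_const inv_lim] by simp
  qed (use T_bounds in auto)
  have grid: "(\<integral>\<^sup>+\<omega>\<in>?A. ?J (T n \<omega>) \<omega> \<partial>M) = (\<integral>\<^sup>+\<omega>\<in>?A. ?R (T n \<omega>) \<omega> \<partial>M)" for n
    unfolding T_def by (rule strong_markov_grid[OF \<theta> s _ A F]) simp
  have "(\<lambda>n. \<integral>\<^sup>+\<omega>\<in>?A. ?R (T n \<omega>) \<omega> \<partial>M) \<longlonglongrightarrow> (\<integral>\<^sup>+\<omega>\<in>?A. potential \<theta> F 1 * ennreal (exp (- (\<theta>\<^sup>2 / 2 * \<tau> \<omega>))) \<partial>M)"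
  proof (rule nn_integral_dominated_convergence[where w = "\<lambda>_. ennreal (2 / \<theta>\<^sup>2)"])
    show "AE \<omega> in M. ?R (T j \<omega>) \<omega> * indicator ?A \<omega> \<le> ennreal (2 / \<theta>\<^sup>2)" for j
    proof (rule AE_I2)
      fix \<omega>
      have "?R (T j \<omega>) \<omega> \<le> 1 * ennreal (2 / \<theta>\<^sup>2)" if "\<omega> \<in> ?A"
      proof (intro mult_mono potential_le[OF \<theta> F le])
        have "0 \<le> T j \<omega>" using that s T_bounds(1)[of \<omega> j] by auto
        then show "ennreal (exp (- (\<theta>\<^sup>2 / 2 * T j \<omega>))) \<le> 1" by simp
      qed auto
      then show "?R (T j \<omega>) \<omega> * indicator ?A \<omega> \<le> ennreal (2 / \<theta>\<^sup>2)" by (auto split: split_indicator)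
    qed
    show "AE \<omega> in M. (\<lambda>j. ?R (T j \<omega>) \<omega> * indicator ?A \<omega>) \<longlonglongrightarrow> potential \<theta> F 1 * ennreal (exp (- (\<theta>\<^sup>2 / 2 * \<tau> \<omega>))) * indicator ?A \<omega>"
    proof (rule AE_I2)
      fix \<omega>
      have "(\<lambda>j. ?R (T j \<omega>) \<omega>) \<longlonglongrightarrow> potential \<theta> F 1 * ennreal (exp (- (\<theta>\<^sup>2 / 2 * \<tau> \<omega>)))" if "\<omega> \<in> ?A"
      proof -
        have hit: "hits \<omega>" using that by simp
        have "(\<lambda>j. X (T j \<omega>) \<omega>) \<longlonglongrightarrow> X (\<tau> \<omega>) \<omega>"
          by (rule continuous_on_tendsto_compose[OF continuous_on_path[of UNIV \<omega>] T_lim]) auto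
        then have "(\<lambda>j. potential \<theta> F (X (T j \<omega>) \<omega>)) \<longlonglongrightarrow> potential \<theta> F 1"
          using hitting_time_attained(3)[OF hit] by (intro potential_tendsto[OF \<theta> F le]) simp
        \<comment> \<open>the limit of the product is taken in the reals, where multiplication is continuous\<close>
        moreover define u where "u x = enn2real (potential \<theta> F x)" for x
        have u: "potential \<theta> F x = ennreal (u x)" for x
          unfolding u_def by (rule sym, rule ennreal_enn2real) (rule order.strict_trans1[OF potential_le[OF \<theta> F le]], simp)
        have u_nn: "0 \<le> u x" for x by (simp add: u_def)
        ultimately have "(\<lambda>j. u (X (T j \<omega>) \<omega>)) \<longlonglongrightarrow> u 1" by (simp add: u u_nn)
        then have "(\<lambda>j. exp (- (\<theta>\<^sup>2 / 2 * T j \<omega>)) * u (X (T j \<omega>) \<omega>)) \<longlonglongrightarrow> exp (- (\<theta>\<^sup>2 / 2 * \<tau> \<omega>)) * u 1"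
          by (intro tendsto_intros T_lim)
        then show ?thesis
          by (simp add: u ennreal_mult[symmetric] u_nn mult.commute)
      qed
      then show "(\<lambda>j. ?R (T j \<omega>) \<omega> * indicator ?A \<omega>) \<longlonglongrightarrow> potential \<theta> F 1 * ennreal (exp (- (\<theta>\<^sup>2 / 2 * \<tau> \<omega>))) * indicator ?A \<omega>"
        by (auto split: split_indicator)
    qed
    show "(\<integral>\<^sup>+\<omega>. ennreal (2 / \<theta>\<^sup>2) \<partial>M) < \<infinity>" by (simp add: emeasure_space_1)
  qed measurable
  also have "(\<integral>\<^sup>+\<omega>\<in>?A. potential \<theta> F 1 * ennreal (exp (- (\<theta>\<^sup>2 / 2 * \<tau> \<omega>))) \<partial>M)
    = potential \<theta> F 1 * (\<integral>\<^sup>+\<omega>\<in>?A. ennreal (exp (- (\<theta>\<^sup>2 / 2 * \<tau> \<omega>))) \<partial>M)" (is "_ = ?L")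
    by (simp only: mult.assoc) (rule nn_integral_cmult, measurable)
  finally have lim: "(\<lambda>n. \<integral>\<^sup>+\<omega>\<in>?A. ?J (T n \<omega>) \<omega> \<partial>M) \<longlonglongrightarrow> ?L" by (simp only: grid)
  show ?thesis
  proof (rule antisym)
    have "(\<integral>\<^sup>+\<omega>\<in>?A. ?J (\<tau> \<omega>) \<omega> \<partial>M) \<le> (\<integral>\<^sup>+\<omega>\<in>?A. ?J (T n \<omega>) \<omega> \<partial>M) + ennreal (1 / Suc n)" for n
    proof -
      have "(\<integral>\<^sup>+\<omega>\<in>?A. ?J (\<tau> \<omega>) \<omega> \<partial>M) \<le> (\<integral>\<^sup>+\<omega>. ?J (T n \<omega>) \<omega> * indicator ?A \<omega> + ennreal (1 / Suc n) \<partial>M)"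
      proof (rule nn_integral_mono)
        fix \<omega>
        have "?J (\<tau> \<omega>) \<omega> \<le> ?J (T n \<omega>) \<omega> + ennreal (1 / Suc n)" if "\<omega> \<in> ?A"
        proof -
          have "?J (\<tau> \<omega>) \<omega> \<le> (\<integral>\<^sup>+r. ennreal (exp (- (\<theta>\<^sup>2 / 2 * r))) * F (X r \<omega>) * indicator {T n \<omega><..} r
              + indicator {\<tau> \<omega>..T n \<omega>} r \<partial>lborel)"
          proof (rule nn_integral_mono)
            fix r :: real
            have "ennreal (exp (- (\<theta>\<^sup>2 / 2 * r))) * F (X r \<omega>) \<le> 1" if "\<tau> \<omega> < r"
            proof -
              have "0 \<le> r" using that \<open>\<omega> \<in> ?A\<close> s by auto
              then have "ennreal (exp (- (\<theta>\<^sup>2 / 2 * r))) * F (X r \<omega>) \<le> 1 * 1"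
                using le by (intro mult_mono) auto
              then show ?thesis by simp
            qed
            then show "ennreal (exp (- (\<theta>\<^sup>2 / 2 * r))) * F (X r \<omega>) * indicator {\<tau> \<omega><..} r
              \<le> ennreal (exp (- (\<theta>\<^sup>2 / 2 * r))) * F (X r \<omega>) * indicator {T n \<omega><..} r + indicator {\<tau> \<omega>..T n \<omega>} r"
              by (auto split: split_indicator)
          qed
          also have "\<dots> = ?J (T n \<omega>) \<omega> + (\<integral>\<^sup>+r. indicator {\<tau> \<omega>..T n \<omega>} r \<partial>lborel)"
            using that by (intro nn_integral_add) (auto intro!: measurable_X_compose)
          also have "(\<integral>\<^sup>+r. indicator {\<tau> \<omega>..T n \<omega>} r \<partial>lborel) = ennreal (T n \<omega> - \<tau> \<omega>)"
            using T_bounds(1)[of \<omega> n] by simp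
          also have "\<dots> \<le> ennreal (1 / Suc n)"
            using T_bounds(2)[of n \<omega>] by (intro ennreal_leI) simp
          finally show ?thesis by (simp add: add_left_mono)
        qed
        then show "?J (\<tau> \<omega>) \<omega> * indicator ?A \<omega> \<le> ?J (T n \<omega>) \<omega> * indicator ?A \<omega> + ennreal (1 / Suc n)"
          by (auto split: split_indicator)
      qed
      also have "\<dots> = (\<integral>\<^sup>+\<omega>\<in>?A. ?J (T n \<omega>) \<omega> \<partial>M) + ennreal (1 / Suc n)"
        by (subst nn_integral_add, measurable) (simp add: emeasure_space_1)
      finally show ?thesis .
    qed
    moreover have "(\<lambda>n. (\<integral>\<^sup>+\<omega>\<in>?A. ?J (T n \<omega>) \<omega> \<partial>M) + ennreal (1 / Suc n)) \<longlonglongrightarrow> ?L + ennreal 0"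
      by (intro tendsto_add lim tendsto_ennrealI inv_lim)
    ultimately show "(\<integral>\<^sup>+\<omega>\<in>?A. ?J (\<tau> \<omega>) \<omega> \<partial>M) \<le> ?L"
      by (intro LIMSEQ_le_const) auto
    have "(\<integral>\<^sup>+\<omega>\<in>?A. ?J (T n \<omega>) \<omega> \<partial>M) \<le> (\<integral>\<^sup>+\<omega>\<in>?A. ?J (\<tau> \<omega>) \<omega> \<partial>M)" for n
      using T_bounds(1)[of _ n]
      by (intro nn_integral_mono mult_right_mono) (auto split: split_indicator intro: order.strict_trans1)
    then show "?L \<le> (\<integral>\<^sup>+\<omega>\<in>?A. ?J (\<tau> \<omega>) \<omega> \<partial>M)"
      by (intro LIMSEQ_le_const2[OF lim]) auto
  qed
qed

end

section \<open>Occupation before the hitting time\<close>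

text \<open>
  Below level \<open>1\<close> the potential of \<open>(1,\<infinity>)\<close> is a multiple of \<open>exp(\<theta>x)\<close>; it serves as a bounded
  substitute for the exponential martingale.
\<close>

lemma potential_indicator_Ioi:
  assumes \<theta>: "0 < \<theta>" and x: "x \<le> 1"
  shows "potential \<theta> (indicator {1<..}) x = ennreal (exp (- (\<theta> * (1 - x))) / \<theta>\<^sup>2)"
proof -
  have "potential \<theta> (indicator {1<..}) x = (\<integral>\<^sup>+y. ennreal (exp (\<theta> * x) / \<theta>) * (ennreal (exp (- (\<theta> * y))) * indicator {1<..} y) \<partial>lborel)"
    unfolding potential_def
  proof (rule nn_integral_cong)
    fix y :: real
    have "exp (- (\<theta> * \<bar>y - x\<bar>)) = exp (\<theta> * x) * exp (- (\<theta> * y))" if "1 < y"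
      using that x by (simp add: exp_add[symmetric] algebra_simps)
    then show "ennreal (exp (- (\<theta> * \<bar>y - x\<bar>)) / \<theta>) * indicator {1<..} y
        = ennreal (exp (\<theta> * x) / \<theta>) * (ennreal (exp (- (\<theta> * y))) * indicator {1<..} y)"
      using \<theta> by (auto simp: ennreal_mult[symmetric] split: split_indicator)
  qed
  also have "\<dots> = ennreal (exp (\<theta> * x) / \<theta>) * ennreal (exp (- (\<theta> * 1)) / \<theta>)"
    using \<theta> by (subst nn_integral_cmult) (auto simp: nn_integral_exp_Ioi)
  also have "\<dots> = ennreal (exp (- (\<theta> * (1 - x))) / \<theta>\<^sup>2)"
    using \<theta> by (simp add: ennreal_mult[symmetric] exp_add[symmetric] exp_minus exp_diff power2_eq_square field_simps)
  finally show ?thesis .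
qed

lemma potential_reflect:
  assumes [measurable]: "F \<in> borel_measurable borel"
  shows "potential \<theta> (\<lambda>y. F (2 - y)) x = potential \<theta> F (2 - x)"
  unfolding potential_def
  by (subst nn_integral_real_affine[where c = "-1" and t = 2]) (auto intro!: nn_integral_cong simp: abs_minus_commute algebra_simps)

text \<open>
  For \<open>x < 1\<close> this is \<open>exp(-\<theta>(1 - x)) (exp(-\<theta>\<bar>x\<bar>) - exp(-\<theta>(2 - x))) / \<theta>\<close>: the Green function at \<open>(0, x)\<close>
  of Brownian motion killed at \<open>1\<close>, times the Laplace transform of the hitting time of \<open>1\<close> from \<open>x\<close>.
\<close>

definition killed_density :: "real \<Rightarrow> real \<Rightarrow> real" where
  "killed_density \<theta> x = (exp (- (\<theta> * (\<bar>x\<bar> + 1 - x))) - exp (- (\<theta> * (3 - 2 * x)))) / \<theta>"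

lemma borel_measurable_killed_density [measurable]:
  assumes [measurable]: "f \<in> borel_measurable N" "g \<in> borel_measurable N"
  shows "(\<lambda>w. killed_density (f w) (g w)) \<in> borel_measurable N"
  unfolding killed_density_def by measurable

context continuous_brownian_motion
begin

text \<open>
  The conditional Laplace transform of the hitting time. Before \<open>\<tau>\<close> the path spends no time in \<open>(1,\<infinity>)\<close>,
  so the discounted time spent there after \<open>s\<close> equals that spent after \<open>\<tau>\<close>. The Markov property at
  \<open>s\<close> evaluates the first, the strong Markov property at \<open>\<tau>\<close> the second; the common
  factor, the potential at \<open>1\<close>, cancels.
\<close>

lemma hitting_transform_past:
  assumes \<theta>: "0 < \<theta>" and s: "0 \<le> s" and A: "A \<in> sets (past s)"
  shows "(\<integral>\<^sup>+\<omega>\<in>A \<inter> {\<omega>\<in>space M. hits \<omega> \<and> s < \<tau> \<omega>}. ennreal (exp (- (\<theta>\<^sup>2 / 2 * \<tau> \<omega>))) \<partial>M)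
    = (\<integral>\<^sup>+\<omega>\<in>A \<inter> survives s. ennreal (exp (- (\<theta>\<^sup>2 / 2 * s)) * exp (- (\<theta> * (1 - X s \<omega>)))) \<partial>M)"
proof -
  let ?F = "indicator {1<..} :: real \<Rightarrow> ennreal"
  let ?J = "\<lambda>v \<omega>. \<integral>\<^sup>+r\<in>{v<..}. ennreal (exp (- (\<theta>\<^sup>2 / 2 * r))) * ?F (X r \<omega>) \<partial>lborel"
  let ?H = "{\<omega>\<in>space M. hits \<omega> \<and> s < \<tau> \<omega>}"
  define U where "U = ennreal (1 / \<theta>\<^sup>2)"
  have U: "U \<noteq> 0" "U \<noteq> top" "potential \<theta> ?F 1 = U"
    using \<theta> by (auto simp: U_def potential_indicator_Ioi)
  have AS: "A \<inter> survives s \<in> sets (past s)" using A sets_survives[OF s] by auto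
  have [measurable]: "A \<in> events" "A \<inter> survives s \<in> events" using A AS sets_past_subset[of s] by auto
  have "U * (\<integral>\<^sup>+\<omega>\<in>A \<inter> ?H. ennreal (exp (- (\<theta>\<^sup>2 / 2 * \<tau> \<omega>))) \<partial>M) = (\<integral>\<^sup>+\<omega>\<in>A \<inter> ?H. ?J (\<tau> \<omega>) \<omega> \<partial>M)"
    unfolding U(3)[symmetric]
    by (rule strong_markov_resolvent[OF \<theta> s A, symmetric]) (auto split: split_indicator)
  also have "\<dots> = (\<integral>\<^sup>+\<omega>\<in>A \<inter> survives s. ?J s \<omega> \<partial>M)"
  proof (rule nn_integral_cong)
    fix \<omega> assume \<omega>: "\<omega> \<in> space M"
    show "?J (\<tau> \<omega>) \<omega> * indicator (A \<inter> ?H) \<omega> = ?J s \<omega> * indicator (A \<inter> survives s) \<omega>"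
    proof (cases "hits \<omega>")
      case True
      have "?J (\<tau> \<omega>) \<omega> = ?J s \<omega>" if "s < \<tau> \<omega>"
      proof (rule nn_integral_cong)
        fix r :: real
        have "X r \<omega> \<le> 1" if "r \<le> \<tau> \<omega>"
          using that hitting_time_attained(3,4)[OF True] by (cases "r = \<tau> \<omega>") (auto intro: less_imp_le)
        then show "ennreal (exp (- (\<theta>\<^sup>2 / 2 * r))) * ?F (X r \<omega>) * indicator {\<tau> \<omega><..} r
          = ennreal (exp (- (\<theta>\<^sup>2 / 2 * r))) * ?F (X r \<omega>) * indicator {s<..} r"
          using \<open>s < \<tau> \<omega>\<close> by (force split: split_indicator)
      qed
      then show ?thesis
        using \<omega> True survives_iff[OF s \<omega>] by (auto split: split_indicator)
    next
      case False
      then have "?J s \<omega> = (\<integral>\<^sup>+r. 0 \<partial>(lborel :: real measure))"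
        using not_hits(2)[OF False] by (intro nn_integral_cong) (auto split: split_indicator simp: not_less less_imp_le)
      then show ?thesis using False by simp
    qed
  qed
  also have "\<dots> = (\<integral>\<^sup>+\<omega>\<in>A \<inter> survives s. ennreal (exp (- (\<theta>\<^sup>2 / 2 * s))) * potential \<theta> ?F (X s \<omega>) \<partial>M)"
    by (rule markov_resolvent[OF \<theta> s AS]) simp
  also have "\<dots> = (\<integral>\<^sup>+\<omega>. U * (ennreal (exp (- (\<theta>\<^sup>2 / 2 * s)) * exp (- (\<theta> * (1 - X s \<omega>)))) * indicator (A \<inter> survives s) \<omega>) \<partial>M)"
  proof (rule nn_integral_cong)
    fix \<omega>
    have "X s \<omega> \<le> 1" if "\<omega> \<in> survives s" using that s by (auto simp: survives_def intro: less_imp_le)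
    then show "ennreal (exp (- (\<theta>\<^sup>2 / 2 * s))) * potential \<theta> ?F (X s \<omega>) * indicator (A \<inter> survives s) \<omega>
      = U * (ennreal (exp (- (\<theta>\<^sup>2 / 2 * s)) * exp (- (\<theta> * (1 - X s \<omega>)))) * indicator (A \<inter> survives s) \<omega>)"
      using \<theta> by (auto simp: U_def potential_indicator_Ioi ennreal_mult[symmetric] split: split_indicator)
  qed
  also have "\<dots> = U * (\<integral>\<^sup>+\<omega>\<in>A \<inter> survives s. ennreal (exp (- (\<theta>\<^sup>2 / 2 * s)) * exp (- (\<theta> * (1 - X s \<omega>)))) \<partial>M)"
    by (rule nn_integral_cmult) measurable
  finally show ?thesis
    using U(1,2) by (simp add: ennreal_mult_cancel_left)
qed

text \<open>
  The reflection principle. By the strong Markov property the discounted integrals after \<open>\<tau>\<close> of \<open>F\<close> and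
  of its mirror image \<open>F' y = F (2 - y)\<close> have the same expectation, as both potentials agree at \<open>1\<close>. Since
  \<open>F'\<close> vanishes up to level \<open>1\<close>, the integral of \<open>F'\<close> after \<open>\<tau>\<close> is the one over all times, and its
  expectation is the potential of \<open>F'\<close> at \<open>0\<close>, i.e. that of \<open>F\<close> at \<open>2\<close>. Stating the result as a sum
  avoids subtraction in \<^typ>\<open>ennreal\<close>.
\<close>

lemma killed_resolvent:
  assumes \<theta>: "0 < \<theta>" and F[measurable]: "F \<in> borel_measurable borel"
    and le: "\<And>y. F y \<le> 1" and F0: "\<And>y. 1 \<le> y \<Longrightarrow> F y = 0"
  shows "(\<integral>\<^sup>+\<omega>. \<integral>\<^sup>+r. ennreal (exp (- (\<theta>\<^sup>2 / 2 * r))) * F (X r \<omega>) * indicator {r. 0 < r \<and> (hits \<omega> \<longrightarrow> r < \<tau> \<omega>)} r \<partial>lborel \<partial>M)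
      + potential \<theta> F 2 = potential \<theta> F 0"
proof -
  let ?e = "\<lambda>r. ennreal (exp (- (\<theta>\<^sup>2 / 2 * r)))"
  let ?J = "\<lambda>F v \<omega>. \<integral>\<^sup>+r\<in>{v<..}. ?e r * F (X r \<omega>) \<partial>lborel"
  let ?H = "{\<omega>\<in>space M. hits \<omega>}"
  define F' where "F' y = F (2 - y)" for y
  have F'[measurable]: "F' \<in> borel_measurable borel" unfolding F'_def[abs_def] by measurable
  have J_meas[measurable]: "(\<lambda>\<omega>. ?J G (f \<omega>) \<omega>) \<in> borel_measurable M"
    if [measurable]: "f \<in> borel_measurable M" "G \<in> borel_measurable borel" for f G
    unfolding greaterThan_iff indicator_def of_bool_def by measurable
  have top: "space M \<in> sets (past 0)" using sets.top[of "past 0"] by simp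
  have start: "(\<integral>\<^sup>+\<omega>. ?J G 0 \<omega> \<partial>M) = potential \<theta> G 0" if G: "G \<in> borel_measurable borel" for G
  proof -
    have "(\<integral>\<^sup>+\<omega>. ?J G 0 \<omega> \<partial>M) = (\<integral>\<^sup>+\<omega>\<in>space M. ?J G 0 \<omega> \<partial>M)"
      by (intro nn_integral_cong) simp
    also have "\<dots> = (\<integral>\<^sup>+\<omega>\<in>space M. ?e 0 * potential \<theta> G (X 0 \<omega>) \<partial>M)"
      by (rule markov_resolvent[OF \<theta> order_refl top G])
    also have "\<dots> = (\<integral>\<^sup>+\<omega>. potential \<theta> G 0 \<partial>M)"
      by (intro nn_integral_cong) (simp add: nonpos)
    finally show ?thesis by (simp add: emeasure_space_1)
  qed
  have strong: "(\<integral>\<^sup>+\<omega>\<in>?H. ?J G (\<tau> \<omega>) \<omega> \<partial>M) = potential \<theta> G 1 * (\<integral>\<^sup>+\<omega>\<in>?H. ?e (\<tau> \<omega>) \<partial>M)"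
    if G: "G \<in> borel_measurable borel" "\<And>y. G y \<le> 1" for G
  proof -
    have "space M \<inter> {\<omega>\<in>space M. hits \<omega> \<and> 0 < \<tau> \<omega>} = ?H"
      using hitting_time_attained(2) by auto
    then show ?thesis using strong_markov_resolvent[OF \<theta> order_refl top G] by simp
  qed
  have "potential \<theta> F 0 = (\<integral>\<^sup>+\<omega>. ?J F 0 \<omega> \<partial>M)" using start[OF F] by simp
  also have "\<dots> = (\<integral>\<^sup>+\<omega>. (\<integral>\<^sup>+r. ?e r * F (X r \<omega>) * indicator {r. 0 < r \<and> (hits \<omega> \<longrightarrow> r < \<tau> \<omega>)} r \<partial>lborel)
      + ?J F (\<tau> \<omega>) \<omega> * indicator ?H \<omega> \<partial>M)"
  proof (rule nn_integral_cong)
    fix \<omega> assume \<omega>: "\<omega> \<in> space M"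
    show "?J F 0 \<omega> = (\<integral>\<^sup>+r. ?e r * F (X r \<omega>) * indicator {r. 0 < r \<and> (hits \<omega> \<longrightarrow> r < \<tau> \<omega>)} r \<partial>lborel) + ?J F (\<tau> \<omega>) \<omega> * indicator ?H \<omega>"
    proof (cases "hits \<omega>")
      case True
      note T = hitting_time_attained[OF True]
      have "?J F 0 \<omega> = (\<integral>\<^sup>+r. ?e r * F (X r \<omega>) * indicator {0<..<\<tau> \<omega>} r + ?e r * F (X r \<omega>) * indicator {\<tau> \<omega><..} r \<partial>lborel)"
      proof (rule nn_integral_cong)
        fix r :: real
        show "?e r * F (X r \<omega>) * indicator {0<..} r = ?e r * F (X r \<omega>) * indicator {0<..<\<tau> \<omega>} r + ?e r * F (X r \<omega>) * indicator {\<tau> \<omega><..} r"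
          \<comment> \<open>at \<open>r = \<tau> \<omega>\<close> both sides vanish, because \<open>F 1 = 0\<close>\<close>
          using T(2,3) F0[of 1] by (cases r "\<tau> \<omega>" rule: linorder_cases) (auto split: split_indicator)
      qed
      also have "\<dots> = (\<integral>\<^sup>+r. ?e r * F (X r \<omega>) * indicator {0<..<\<tau> \<omega>} r \<partial>lborel) + ?J F (\<tau> \<omega>) \<omega>"
        using \<omega> by (intro nn_integral_add) measurable
      also have "{0<..<\<tau> \<omega>} = {r. 0 < r \<and> (hits \<omega> \<longrightarrow> r < \<tau> \<omega>)}" using True by auto
      finally show ?thesis using \<omega> True by simp
    qed (simp add: greaterThan_def)
  qed
  also have "\<dots> = (\<integral>\<^sup>+\<omega>. \<integral>\<^sup>+r. ?e r * F (X r \<omega>) * indicator {r. 0 < r \<and> (hits \<omega> \<longrightarrow> r < \<tau> \<omega>)} r \<partial>lborel \<partial>M)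
      + (\<integral>\<^sup>+\<omega>\<in>?H. ?J F (\<tau> \<omega>) \<omega> \<partial>M)"
  proof (rule nn_integral_add)
    show "(\<lambda>\<omega>. \<integral>\<^sup>+r. ?e r * F (X r \<omega>) * indicator {r. 0 < r \<and> (hits \<omega> \<longrightarrow> r < \<tau> \<omega>)} r \<partial>lborel) \<in> borel_measurable M"
      unfolding indicator_def of_bool_def mem_Collect_eq by measurable
  qed measurable
  also have "(\<integral>\<^sup>+\<omega>\<in>?H. ?J F (\<tau> \<omega>) \<omega> \<partial>M) = (\<integral>\<^sup>+\<omega>\<in>?H. ?J F' (\<tau> \<omega>) \<omega> \<partial>M)"
    using potential_reflect[OF F, of \<theta> 1] le
    by (subst (1 2) strong) (auto simp: F'_def[abs_def])
  also have "\<dots> = (\<integral>\<^sup>+\<omega>. ?J F' 0 \<omega> \<partial>M)"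
  proof (rule nn_integral_cong)
    fix \<omega> assume \<omega>: "\<omega> \<in> space M"
    have F'0: "F' y = 0" if "y \<le> 1" for y using that by (simp add: F'_def F0)
    show "?J F' (\<tau> \<omega>) \<omega> * indicator ?H \<omega> = ?J F' 0 \<omega>"
    proof (cases "hits \<omega>")
      case True
      note T = hitting_time_attained[OF True]
      have "X r \<omega> \<le> 1" if "r \<le> \<tau> \<omega>" for r
        using that T(3,4) by (cases "r = \<tau> \<omega>") (auto intro: less_imp_le)
      then have "?J F' (\<tau> \<omega>) \<omega> = ?J F' 0 \<omega>"
        using T(2) F'0 by (intro nn_integral_cong) (force split: split_indicator)
      then show ?thesis using \<omega> True by simp
    next
      case False
      then have "F' (X r \<omega>) = 0" for r using not_hits(2)[OF False, of r] by (intro F'0) simp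
      then show ?thesis using False by simp
    qed
  qed
  also have "\<dots> = potential \<theta> F 2"
    using start[OF F'] potential_reflect[OF F, of \<theta> 0] by (simp add: F'_def[abs_def])
  finally show ?thesis by simp
qed

text \<open>
  For each fixed \<open>s\<close>, \<open>exp(-\<theta>\<^sup>2\<tau>/2)\<close> is replaced by its conditional expectation given the past of \<open>s\<close>. The
  result is the resolvent of the killed motion for \<open>F(x) = exp(-\<theta>(1 - x))\<close> on \<open>C \<inter> {..<1}\<close>, bounded by \<open>1\<close>.
\<close>

lemma occupation_transform_indicator:
  assumes \<theta>: "0 < \<theta>" and C[measurable]: "C \<in> sets borel"
  shows "(\<integral>\<^sup>+\<omega>. \<integral>\<^sup>+s. ennreal (exp (- (\<theta>\<^sup>2 / 2 * \<tau> \<omega>))) * indicator {s. 0 < s \<and> hits \<omega> \<and> s < \<tau> \<omega>} s * indicator C (X s \<omega>) \<partial>lborel \<partial>M)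
    = (\<integral>\<^sup>+x\<in>{..<1}. ennreal (killed_density \<theta> x) * indicator C x \<partial>lborel)"
proof -
  interpret pair_sigma_finite M lborel ..
  define F where "F x = ennreal (exp (- (\<theta> * (1 - x)))) * indicator (C \<inter> {..<1}) x" for x
  have F[measurable]: "F \<in> borel_measurable borel" unfolding F_def[abs_def] by measurable
  have F_le: "F y \<le> 1" and F0: "1 \<le> y \<Longrightarrow> F y = 0" for y
    using \<theta> by (auto simp: F_def split: split_indicator)
  let ?e = "\<lambda>r. ennreal (exp (- (\<theta>\<^sup>2 / 2 * r)))"
  let ?L = "\<integral>\<^sup>+\<omega>. \<integral>\<^sup>+s. ?e (\<tau> \<omega>) * indicator {s. 0 < s \<and> hits \<omega> \<and> s < \<tau> \<omega>} s * indicator C (X s \<omega>) \<partial>lborel \<partial>M"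
  have "?L = (\<integral>\<^sup>+s. \<integral>\<^sup>+\<omega>. ?e (\<tau> \<omega>) * indicator {s. 0 < s \<and> hits \<omega> \<and> s < \<tau> \<omega>} s * indicator C (X s \<omega>) \<partial>M \<partial>lborel)"
    unfolding indicator_def of_bool_def mem_Collect_eq by (rule Fubini'[symmetric]) measurable
  also have "\<dots> = (\<integral>\<^sup>+s. \<integral>\<^sup>+\<omega>. ?e s * F (X s \<omega>) * indicator {r. 0 < r \<and> (hits \<omega> \<longrightarrow> r < \<tau> \<omega>)} s \<partial>M \<partial>lborel)"
  proof (rule nn_integral_cong)
    fix s :: real
    show "(\<integral>\<^sup>+\<omega>. ?e (\<tau> \<omega>) * indicator {s. 0 < s \<and> hits \<omega> \<and> s < \<tau> \<omega>} s * indicator C (X s \<omega>) \<partial>M)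
      = (\<integral>\<^sup>+\<omega>. ?e s * F (X s \<omega>) * indicator {r. 0 < r \<and> (hits \<omega> \<longrightarrow> r < \<tau> \<omega>)} s \<partial>M)"
    proof (cases "0 < s")
      case s: True
      define A where "A = X s -` C \<inter> space M"
      have A: "A \<in> sets (past s)"
        using measurable_sets[OF measurable_X_past[of s s] C] s by (simp add: A_def)
      have "(\<integral>\<^sup>+\<omega>. ?e (\<tau> \<omega>) * indicator {s. 0 < s \<and> hits \<omega> \<and> s < \<tau> \<omega>} s * indicator C (X s \<omega>) \<partial>M)
        = (\<integral>\<^sup>+\<omega>\<in>A \<inter> {\<omega>\<in>space M. hits \<omega> \<and> s < \<tau> \<omega>}. ?e (\<tau> \<omega>) \<partial>M)"
        using s by (intro nn_integral_cong) (auto simp: A_def split: split_indicator)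
      also have "\<dots> = (\<integral>\<^sup>+\<omega>\<in>A \<inter> survives s. ennreal (exp (- (\<theta>\<^sup>2 / 2 * s)) * exp (- (\<theta> * (1 - X s \<omega>)))) \<partial>M)"
        using s by (intro hitting_transform_past \<theta> A) simp
      also have "\<dots> = (\<integral>\<^sup>+\<omega>. ?e s * F (X s \<omega>) * indicator {r. 0 < r \<and> (hits \<omega> \<longrightarrow> r < \<tau> \<omega>)} s \<partial>M)"
      proof (rule nn_integral_cong)
        fix \<omega> assume \<omega>: "\<omega> \<in> space M"
        have "X s \<omega> < 1" if "\<omega> \<in> survives s" using that s by (auto simp: survives_def)
        then show "ennreal (exp (- (\<theta>\<^sup>2 / 2 * s)) * exp (- (\<theta> * (1 - X s \<omega>)))) * indicator (A \<inter> survives s) \<omega>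
          = ?e s * F (X s \<omega>) * indicator {r. 0 < r \<and> (hits \<omega> \<longrightarrow> r < \<tau> \<omega>)} s"
          using s \<omega> survives_iff[of s \<omega>]
          by (auto simp: A_def F_def ennreal_mult split: split_indicator)
      qed
      finally show ?thesis .
    qed simp
  qed
  also have "\<dots> = (\<integral>\<^sup>+\<omega>. \<integral>\<^sup>+s. ?e s * F (X s \<omega>) * indicator {r. 0 < r \<and> (hits \<omega> \<longrightarrow> r < \<tau> \<omega>)} s \<partial>lborel \<partial>M)"
    unfolding indicator_def of_bool_def mem_Collect_eq by (rule Fubini') measurable
  finally have L: "?L + potential \<theta> F 2 = potential \<theta> F 0"
    using killed_resolvent[OF \<theta> F F_le F0] by simp
  let ?R = "\<integral>\<^sup>+x\<in>{..<1}. ennreal (killed_density \<theta> x) * indicator C x \<partial>lborel"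
  have "?R + potential \<theta> F 2 = (\<integral>\<^sup>+x. ennreal (killed_density \<theta> x) * indicator C x * indicator {..<1} x + ennreal (exp (- (\<theta> * \<bar>x - 2\<bar>)) / \<theta>) * F x \<partial>lborel)"
    unfolding potential_def by (rule nn_integral_add[symmetric]) measurable
  also have "\<dots> = potential \<theta> F 0"
    unfolding potential_def
  proof (rule nn_integral_cong)
    fix x :: real
    have "ennreal (killed_density \<theta> x) + ennreal (exp (- (\<theta> * \<bar>x - 2\<bar>)) / \<theta>) * ennreal (exp (- (\<theta> * (1 - x))))
       = ennreal (exp (- (\<theta> * \<bar>x - 0\<bar>)) / \<theta>) * ennreal (exp (- (\<theta> * (1 - x))))" if x: "x < 1"
    proof -
      have e1: "exp (- (\<theta> * \<bar>x - 2\<bar>)) / \<theta> * exp (- (\<theta> * (1 - x))) = exp (- (\<theta> * (3 - 2 * x))) / \<theta>"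
        and e2: "exp (- (\<theta> * \<bar>x - 0\<bar>)) / \<theta> * exp (- (\<theta> * (1 - x))) = exp (- (\<theta> * (\<bar>x\<bar> + 1 - x))) / \<theta>"
        using x by (simp_all add: exp_add[symmetric] algebra_simps)
      have "\<theta> * (\<bar>x\<bar> + 1 - x) \<le> \<theta> * (3 - 2 * x)" using x \<theta> by (intro mult_left_mono) auto
      then have "0 \<le> killed_density \<theta> x" using \<theta> by (simp add: killed_density_def)
      then have "ennreal (killed_density \<theta> x) + ennreal (exp (- (\<theta> * \<bar>x - 2\<bar>)) / \<theta> * exp (- (\<theta> * (1 - x))))
         = ennreal (exp (- (\<theta> * \<bar>x - 0\<bar>)) / \<theta> * exp (- (\<theta> * (1 - x))))"
        unfolding e1 e2 using \<theta>
        by (subst ennreal_plus[symmetric]) (auto simp: killed_density_def diff_divide_distrib)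
      then show ?thesis
        using ennreal_mult'[of "exp (- (\<theta> * \<bar>x - 2\<bar>)) / \<theta>" "exp (- (\<theta> * (1 - x)))"]
          ennreal_mult'[of "exp (- (\<theta> * \<bar>x - 0\<bar>)) / \<theta>" "exp (- (\<theta> * (1 - x)))"] \<theta>
        by (metis divide_nonneg_pos exp_ge_zero)
    qed
    then show "ennreal (killed_density \<theta> x) * indicator C x * indicator {..<1} x + ennreal (exp (- (\<theta> * \<bar>x - 2\<bar>)) / \<theta>) * F x
       = ennreal (exp (- (\<theta> * \<bar>x - 0\<bar>)) / \<theta>) * F x"
      by (auto simp: F_def split: split_indicator)
  qed
  finally have R: "?R + potential \<theta> F 2 = potential \<theta> F 0" .
  have "potential \<theta> F 2 \<noteq> top"
    using potential_le[OF \<theta> F F_le, of 2] by (auto simp: top_unique)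
  then show "?L = ?R"
    using L R ennreal_add_left_cancel[of "potential \<theta> F 2" ?L ?R] by (simp add: add.commute)
qed

text \<open>
  Both sides are integrals of \<open>f\<close> with respect to a measure on the line, and the two measures agree on
  Borel sets by the previous lemma. This removes the boundedness required by the strong Markov property.
\<close>

lemma occupation_transform:
  assumes \<theta>: "0 < \<theta>" and f[measurable]: "f \<in> borel_measurable borel"
  shows "(\<integral>\<^sup>+\<omega>. \<integral>\<^sup>+s. ennreal (exp (- (\<theta>\<^sup>2 / 2 * \<tau> \<omega>))) * indicator {s. 0 < s \<and> hits \<omega> \<and> s < \<tau> \<omega>} s * f (X s \<omega>) \<partial>lborel \<partial>M)
    = (\<integral>\<^sup>+x\<in>{..<1}. ennreal (killed_density \<theta> x) * f x \<partial>lborel)"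
proof -
  define W where "W \<omega> s = ennreal (exp (- (\<theta>\<^sup>2 / 2 * \<tau> \<omega>))) * indicator {s. 0 < s \<and> hits \<omega> \<and> s < \<tau> \<omega>} s" for \<omega> s
  let ?W = "\<lambda>p. W (fst p) (snd p)" and ?X = "\<lambda>p. X (snd p) (fst p)"
  let ?\<mu> = "distr (density (M \<Otimes>\<^sub>M lborel) ?W) borel ?X"
  let ?\<nu> = "density lborel (\<lambda>x. ennreal (killed_density \<theta> x) * indicator {..<1} x)"
  have W[measurable]: "?W \<in> borel_measurable (M \<Otimes>\<^sub>M lborel)"
    unfolding W_def indicator_def of_bool_def mem_Collect_eq by measurable
  have X[measurable]: "?X \<in> borel_measurable (M \<Otimes>\<^sub>M lborel)" by measurable
  have \<mu>: "(\<integral>\<^sup>+x. g x \<partial>?\<mu>) = (\<integral>\<^sup>+\<omega>. \<integral>\<^sup>+s. W \<omega> s * g (X s \<omega>) \<partial>lborel \<partial>M)"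
    if g: "g \<in> borel_measurable borel" for g
  proof -
    have gX: "(\<lambda>p. g (?X p)) \<in> borel_measurable (M \<Otimes>\<^sub>M lborel)" by (rule measurable_compose[OF X g])
    have "(\<integral>\<^sup>+x. g x \<partial>?\<mu>) = (\<integral>\<^sup>+p. g (?X p) \<partial>density (M \<Otimes>\<^sub>M lborel) ?W)"
      using X g by (intro nn_integral_distr) auto
    also have "\<dots> = (\<integral>\<^sup>+p. ?W p * g (?X p) \<partial>(M \<Otimes>\<^sub>M lborel))"
      by (rule nn_integral_density[OF W gX])
    also have "\<dots> = (\<integral>\<^sup>+\<omega>. \<integral>\<^sup>+s. ?W (\<omega>, s) * g (?X (\<omega>, s)) \<partial>lborel \<partial>M)"
      by (rule lborel.nn_integral_fst[symmetric]) (rule borel_measurable_times_ennreal[OF W gX])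
    finally show ?thesis by simp
  qed
  have \<nu>: "(\<integral>\<^sup>+x. g x \<partial>?\<nu>) = (\<integral>\<^sup>+x\<in>{..<1}. ennreal (killed_density \<theta> x) * g x \<partial>lborel)"
    if g[measurable]: "g \<in> borel_measurable borel" for g
    by (subst nn_integral_density) (auto intro!: nn_integral_cong simp: mult_ac)
  have "?\<mu> = ?\<nu>"
  proof (rule measure_eqI)
    fix C assume "C \<in> sets ?\<mu>"
    then have C[measurable]: "C \<in> sets borel" by simp
    have ind: "(indicator C :: real \<Rightarrow> ennreal) \<in> borel_measurable borel" by simp
    have "emeasure ?\<mu> C = (\<integral>\<^sup>+x. indicator C x \<partial>?\<mu>)"
      using \<open>C \<in> sets ?\<mu>\<close> by (rule nn_integral_indicator[symmetric])
    also have "\<dots> = (\<integral>\<^sup>+x. indicator C x \<partial>?\<nu>)"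
      unfolding \<mu>[OF ind] \<nu>[OF ind] unfolding W_def by (rule occupation_transform_indicator[OF \<theta> C])
    also have "\<dots> = emeasure ?\<nu> C" by simp
    finally show "emeasure ?\<mu> C = emeasure ?\<nu> C" .
  qed simp
  then show ?thesis using \<mu>[OF f] \<nu>[OF f] by (simp add: W_def)
qed

section \<open>The two expectations\<close>

text \<open>
  Mix the exponentials in \<open>\<tau>\<close> over \<open>\<theta>\<close> with weight \<open>\<theta>^(m+1)\<close>. On the left this produces the power of \<open>\<tau>\<close> up to the
  constant \<open>D = 2^(m/2) \<Gamma>(1 + m/2)\<close>, on the right the powers of \<open>\<bar>x\<bar> + 1 - x\<close> and \<open>3 - 2x\<close> up to \<open>\<Gamma>(1 + m)\<close>;
  and \<open>c_m m = \<Gamma>(1 + m) / D\<close>.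
\<close>

lemma scaled_occupation:
  assumes m: "0 \<le> m" and f[measurable]: "f \<in> borel_measurable borel"
  shows "(\<integral>\<^sup>+\<omega>\<in>{\<omega>. hits \<omega>}. ennreal (1 / \<tau> \<omega> powr (1 + m / 2)) * (\<integral>\<^sup>+s\<in>{0<..<\<tau> \<omega>}. f (X s \<omega>) \<partial>lborel) \<partial>M)
    = ennreal (c_m m) * (\<integral>\<^sup>+x\<in>{..<1}. ennreal ((\<bar>x\<bar> + 1 - x) powr - (m + 1) - (3 - 2 * x) powr - (m + 1)) * f x \<partial>lborel)"
    (is "?L = _ * ?R")
proof -
  interpret pair_sigma_finite M lborel ..
  define D where "D = 2 powr (m / 2) * Gamma (1 + m / 2)"
  have D: "0 < D" using m by (auto simp: D_def intro!: mult_pos_pos Gamma_real_pos)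
  define w where "w \<theta> = ennreal (\<theta> powr (m + 1)) * indicator {0<..} \<theta>" for \<theta> :: real
  have w[measurable]: "w \<in> borel_measurable borel" unfolding w_def[abs_def] by measurable
  define Occ where "Occ \<omega> = (\<integral>\<^sup>+s. indicator {s. 0 < s \<and> hits \<omega> \<and> s < \<tau> \<omega>} s * f (X s \<omega>) \<partial>lborel)" for \<omega>
  have Occ[measurable]: "Occ \<in> borel_measurable M"
    unfolding Occ_def[abs_def] indicator_def of_bool_def mem_Collect_eq by measurable
  have "ennreal D * ?L = (\<integral>\<^sup>+\<omega>. \<integral>\<^sup>+\<theta>. w \<theta> * (ennreal (exp (- (\<theta>\<^sup>2 / 2 * \<tau> \<omega>))) * Occ \<omega>) \<partial>lborel \<partial>M)"
  proof (subst nn_integral_cmult[symmetric])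
    have "(\<lambda>\<omega>. \<integral>\<^sup>+s\<in>{0<..<\<tau> \<omega>}. f (X s \<omega>) \<partial>lborel) \<in> borel_measurable M"
      unfolding indicator_def of_bool_def greaterThanLessThan_iff by measurable
    then show "(\<lambda>\<omega>. ennreal (1 / \<tau> \<omega> powr (1 + m / 2)) * (\<integral>\<^sup>+s\<in>{0<..<\<tau> \<omega>}. f (X s \<omega>) \<partial>lborel) * indicator {\<omega>. hits \<omega>} \<omega>) \<in> borel_measurable M"
      unfolding indicator_def of_bool_def mem_Collect_eq by measurable
    show "(\<integral>\<^sup>+\<omega>. ennreal D * (ennreal (1 / \<tau> \<omega> powr (1 + m / 2)) * (\<integral>\<^sup>+s\<in>{0<..<\<tau> \<omega>}. f (X s \<omega>) \<partial>lborel) * indicator {\<omega>. hits \<omega>} \<omega>) \<partial>M)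
      = (\<integral>\<^sup>+\<omega>. \<integral>\<^sup>+\<theta>. w \<theta> * (ennreal (exp (- (\<theta>\<^sup>2 / 2 * \<tau> \<omega>))) * Occ \<omega>) \<partial>lborel \<partial>M)"
    proof (rule nn_integral_cong)
      fix \<omega>
      show "ennreal D * (ennreal (1 / \<tau> \<omega> powr (1 + m / 2)) * (\<integral>\<^sup>+s\<in>{0<..<\<tau> \<omega>}. f (X s \<omega>) \<partial>lborel) * indicator {\<omega>. hits \<omega>} \<omega>)
        = (\<integral>\<^sup>+\<theta>. w \<theta> * (ennreal (exp (- (\<theta>\<^sup>2 / 2 * \<tau> \<omega>))) * Occ \<omega>) \<partial>lborel)"
      proof (cases "hits \<omega>")
        case True
        have Occ_eq: "Occ \<omega> = (\<integral>\<^sup>+s\<in>{0<..<\<tau> \<omega>}. f (X s \<omega>) \<partial>lborel)"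
          unfolding Occ_def using True by (intro nn_integral_cong) (auto split: split_indicator)
        have "(\<integral>\<^sup>+\<theta>. w \<theta> * (ennreal (exp (- (\<theta>\<^sup>2 / 2 * \<tau> \<omega>))) * Occ \<omega>) \<partial>lborel)
          = (\<integral>\<^sup>+\<theta>. ennreal (\<theta> powr (m + 1) * exp (- (\<theta>\<^sup>2 / 2 * \<tau> \<omega>))) * indicator {0<..} \<theta> * Occ \<omega> \<partial>lborel)"
          by (intro nn_integral_cong) (simp add: w_def ennreal_mult mult_ac)
        also have "\<dots> = (\<integral>\<^sup>+\<theta>. ennreal (\<theta> powr (m + 1) * exp (- (\<theta>\<^sup>2 / 2 * \<tau> \<omega>))) * indicator {0<..} \<theta> \<partial>lborel) * Occ \<omega>"
          by (rule nn_integral_multc) measurable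
        also have "(\<integral>\<^sup>+\<theta>. ennreal (\<theta> powr (m + 1) * exp (- (\<theta>\<^sup>2 / 2 * \<tau> \<omega>))) * indicator {0<..} \<theta> \<partial>lborel)
          = ennreal D * ennreal (1 / \<tau> \<omega> powr (1 + m / 2))"
          using Gamma_integral_half_square[OF hitting_time_attained(2)[OF True] m] D
          by (simp add: D_def[symmetric] ennreal_mult'[symmetric])
        finally show ?thesis using True by (simp add: Occ_eq mult.assoc)
      next
        case False
        then have "Occ \<omega> = 0" by (simp add: Occ_def)
        then show ?thesis using False by simp
      qed
    qed
  qed
  also have "\<dots> = (\<integral>\<^sup>+\<theta>. \<integral>\<^sup>+\<omega>. w \<theta> * (ennreal (exp (- (\<theta>\<^sup>2 / 2 * \<tau> \<omega>))) * Occ \<omega>) \<partial>M \<partial>lborel)"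
    by (rule Fubini'[symmetric]) measurable
  also have "\<dots> = (\<integral>\<^sup>+\<theta>. \<integral>\<^sup>+x. w \<theta> * (ennreal (killed_density \<theta> x) * f x * indicator {..<1} x) \<partial>lborel \<partial>lborel)"
  proof (rule nn_integral_cong)
    fix \<theta> :: real
    show "(\<integral>\<^sup>+\<omega>. w \<theta> * (ennreal (exp (- (\<theta>\<^sup>2 / 2 * \<tau> \<omega>))) * Occ \<omega>) \<partial>M)
      = (\<integral>\<^sup>+x. w \<theta> * (ennreal (killed_density \<theta> x) * f x * indicator {..<1} x) \<partial>lborel)"
    proof (cases "0 < \<theta>")
      case True
      have "(\<integral>\<^sup>+\<omega>. w \<theta> * (ennreal (exp (- (\<theta>\<^sup>2 / 2 * \<tau> \<omega>))) * Occ \<omega>) \<partial>M)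
        = w \<theta> * (\<integral>\<^sup>+\<omega>. ennreal (exp (- (\<theta>\<^sup>2 / 2 * \<tau> \<omega>))) * Occ \<omega> \<partial>M)"
        by (rule nn_integral_cmult) measurable
      also have "(\<integral>\<^sup>+\<omega>. ennreal (exp (- (\<theta>\<^sup>2 / 2 * \<tau> \<omega>))) * Occ \<omega> \<partial>M)
        = (\<integral>\<^sup>+\<omega>. \<integral>\<^sup>+s. ennreal (exp (- (\<theta>\<^sup>2 / 2 * \<tau> \<omega>))) * indicator {s. 0 < s \<and> hits \<omega> \<and> s < \<tau> \<omega>} s * f (X s \<omega>) \<partial>lborel \<partial>M)"
      proof (rule nn_integral_cong)
        fix \<omega> assume \<omega>[measurable]: "\<omega> \<in> space M"
        have [measurable]: "(\<lambda>s. X s \<omega>) \<in> borel_measurable borel" using \<omega> by measurable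
        show "ennreal (exp (- (\<theta>\<^sup>2 / 2 * \<tau> \<omega>))) * Occ \<omega>
          = (\<integral>\<^sup>+s. ennreal (exp (- (\<theta>\<^sup>2 / 2 * \<tau> \<omega>))) * indicator {s. 0 < s \<and> hits \<omega> \<and> s < \<tau> \<omega>} s * f (X s \<omega>) \<partial>lborel)"
          unfolding Occ_def mult.assoc by (rule nn_integral_cmult[symmetric]) measurable
      qed
      also have "\<dots> = (\<integral>\<^sup>+x\<in>{..<1}. ennreal (killed_density \<theta> x) * f x \<partial>lborel)"
        by (rule occupation_transform[OF True f])
      also have "w \<theta> * \<dots> = (\<integral>\<^sup>+x. w \<theta> * (ennreal (killed_density \<theta> x) * f x * indicator {..<1} x) \<partial>lborel)"
        by (rule nn_integral_cmult[symmetric]) measurable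
      finally show ?thesis .
    qed (simp add: w_def)
  qed
  also have "\<dots> = (\<integral>\<^sup>+x. \<integral>\<^sup>+\<theta>. w \<theta> * (ennreal (killed_density \<theta> x) * f x * indicator {..<1} x) \<partial>lborel \<partial>lborel)"
    by (rule lborel_pair.Fubini') measurable
  also have "\<dots> = (\<integral>\<^sup>+x. ennreal (Gamma (1 + m)) * (ennreal ((\<bar>x\<bar> + 1 - x) powr - (m + 1) - (3 - 2 * x) powr - (m + 1)) * f x * indicator {..<1} x) \<partial>lborel)"
  proof (rule nn_integral_cong)
    fix x :: real
    show "(\<integral>\<^sup>+\<theta>. w \<theta> * (ennreal (killed_density \<theta> x) * f x * indicator {..<1} x) \<partial>lborel)
      = ennreal (Gamma (1 + m)) * (ennreal ((\<bar>x\<bar> + 1 - x) powr - (m + 1) - (3 - 2 * x) powr - (m + 1)) * f x * indicator {..<1} x)"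
    proof (cases "x < 1")
      case True
      have "(\<integral>\<^sup>+\<theta>. w \<theta> * (ennreal (killed_density \<theta> x) * f x * indicator {..<1} x) \<partial>lborel)
        = (\<integral>\<^sup>+\<theta>. ennreal (\<theta> powr (m + 1) * killed_density \<theta> x) * indicator {0<..} \<theta> * f x \<partial>lborel)"
        using True by (intro nn_integral_cong) (simp add: w_def ennreal_mult'[OF powr_ge_zero], simp add: mult_ac)
      also have "\<dots> = (\<integral>\<^sup>+\<theta>. ennreal (\<theta> powr (m + 1) * killed_density \<theta> x) * indicator {0<..} \<theta> \<partial>lborel) * f x"
        by (rule nn_integral_multc) measurable
      also have "(\<integral>\<^sup>+\<theta>. ennreal (\<theta> powr (m + 1) * killed_density \<theta> x) * indicator {0<..} \<theta> \<partial>lborel)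
        = ennreal (Gamma (1 + m) * ((\<bar>x\<bar> + 1 - x) powr - (m + 1) - (3 - 2 * x) powr - (m + 1)))"
        unfolding killed_density_def using True m by (intro integral_exp_difference) auto
      also have "\<dots> = ennreal (Gamma (1 + m)) * ennreal ((\<bar>x\<bar> + 1 - x) powr - (m + 1) - (3 - 2 * x) powr - (m + 1))"
        using m by (intro ennreal_mult') (auto intro: Gamma_real_nonneg)
      finally show ?thesis using True by (simp add: mult.assoc)
    qed simp
  qed
  also have "\<dots> = ennreal (Gamma (1 + m)) * ?R"
    by (rule nn_integral_cmult) measurable
  finally have eq: "ennreal D * ?L = ennreal (Gamma (1 + m)) * ?R" .
  have "?L = ennreal (1 / D) * (ennreal D * ?L)"
    using D by (simp add: mult.assoc[symmetric] ennreal_mult[symmetric])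
  also have "\<dots> = ennreal (1 / D * Gamma (1 + m)) * ?R"
    unfolding eq using D by (simp only: mult.assoc[symmetric]) (simp add: ennreal_mult'[symmetric])
  also have "1 / D * Gamma (1 + m) = c_m m" by (simp add: D_def c_m_def)
  finally show ?thesis .
qed

lemma bounded_on_path: "\<exists>K. \<forall>s\<in>{a..b}. \<bar>X s \<omega>\<bar> \<le> K"
proof -
  have "bounded ((\<lambda>s. X s \<omega>) ` {a..b})"
    by (intro compact_imp_bounded compact_continuous_image continuous_on_path) auto
  then show ?thesis by (auto simp: bounded_iff)
qed

text \<open>
  The bound on \<open>g\<close> makes the Bochner integral over the path genuine, so that it equals the nonnegative
  integral; for an integrand that is not integrable it would be \<open>0\<close>.
\<close>

lemma integrand_eq:
  fixes g :: "real \<Rightarrow> real"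
  assumes \<omega>: "\<omega> \<in> space M" and g[measurable]: "g \<in> borel_measurable borel"
    and nonneg: "\<And>x. 0 \<le> g x" and bound: "\<And>K x. \<bar>x\<bar> \<le> K \<Longrightarrow> g x \<le> b K"
  shows "ennreal (1 / real_of_ereal (hitting_time X 1 \<omega>) powr p * (LBINT s=0..hitting_time X 1 \<omega>. g (X s \<omega>)))
    = ennreal (1 / \<tau> \<omega> powr p) * (\<integral>\<^sup>+s\<in>{0<..<\<tau> \<omega>}. ennreal (g (X s \<omega>)) \<partial>lborel) * indicator {\<omega>. hits \<omega>} \<omega>"
proof (cases "hits \<omega>")
  case True
  note T = hitting_time_attained[OF True]
  have [measurable]: "(\<lambda>s. X s \<omega>) \<in> borel_measurable borel" using \<omega> by measurable
  obtain K where K: "\<And>s. s \<in> {0..\<tau> \<omega>} \<Longrightarrow> \<bar>X s \<omega>\<bar> \<le> K" using bounded_on_path[of 0 "\<tau> \<omega>" \<omega>] by blast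
  have ei: "einterval 0 (ereal (\<tau> \<omega>)) = {0<..<\<tau> \<omega>}" by (auto simp: einterval_def zero_ereal_def)
  have "integrable lborel (\<lambda>s. indicator {0<..<\<tau> \<omega>} s * g (X s \<omega>))"
  proof (rule Bochner_Integration.integrable_bound)
    show "integrable lborel (\<lambda>s. indicator {0<..<\<tau> \<omega>} s * b K)" using T(2) by simp
    show "AE s in lborel. norm (indicator {0<..<\<tau> \<omega>} s * g (X s \<omega>)) \<le> norm (indicator {0<..<\<tau> \<omega>} s * b K)"
    proof (rule AE_I2)
      fix s :: real
      have "g (X s \<omega>) \<le> b K" if "0 < s" "s < \<tau> \<omega>" using that K[of s] by (intro bound) auto
      then show "norm (indicator {0<..<\<tau> \<omega>} s * g (X s \<omega>)) \<le> norm (indicator {0<..<\<tau> \<omega>} s * b K)"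
        using nonneg[of "X s \<omega>"] by (auto split: split_indicator)
    qed
  qed measurable
  then have "(\<integral>\<^sup>+s. ennreal (indicator {0<..<\<tau> \<omega>} s * g (X s \<omega>)) \<partial>lborel) = ennreal (LINT s|lborel. indicator {0<..<\<tau> \<omega>} s * g (X s \<omega>))"
    using nonneg by (intro nn_integral_eq_integral) auto
  also have "(LINT s|lborel. indicator {0<..<\<tau> \<omega>} s * g (X s \<omega>)) = (LBINT s=0..hitting_time X 1 \<omega>. g (X s \<omega>))"
    using T(1,2) by (simp add: interval_lebesgue_integral_def ei set_lebesgue_integral_def zero_ereal_def)
  also have "(\<integral>\<^sup>+s. ennreal (indicator {0<..<\<tau> \<omega>} s * g (X s \<omega>)) \<partial>lborel) = (\<integral>\<^sup>+s\<in>{0<..<\<tau> \<omega>}. ennreal (g (X s \<omega>)) \<partial>lborel)"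
    by (intro nn_integral_cong) (auto split: split_indicator)
  finally show ?thesis
    using True T(1) ennreal_mult'[of "1 / \<tau> \<omega> powr p" "LBINT s=0..hitting_time X 1 \<omega>. g (X s \<omega>)"] by simp
next
  case False
  then show ?thesis using not_hits(1)[OF False] by simp
qed

lemma I_plus_eq:
  assumes m: "0 \<le> m"
  shows "I_plus M X m = ennreal (c_m m / 2 powr (m + 1) * phi m)"
proof -
  have bound: "max x 0 powr m \<le> \<bar>K\<bar> powr m" if "\<bar>x\<bar> \<le> K" for x K :: real
    using that m by (intro powr_mono2) auto
  have c: "0 \<le> c_m m" unfolding c_m_def using m by (intro divide_nonneg_nonneg mult_nonneg_nonneg Gamma_real_nonneg) auto
  have "I_plus M X m = (\<integral>\<^sup>+\<omega>\<in>{\<omega>. hits \<omega>}. ennreal (1 / \<tau> \<omega> powr (1 + m / 2)) * (\<integral>\<^sup>+s\<in>{0<..<\<tau> \<omega>}. ennreal (max (X s \<omega>) 0 powr m) \<partial>lborel) \<partial>M)"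
    unfolding I_plus_def by (intro nn_integral_cong integrand_eq[where b = "\<lambda>K. \<bar>K\<bar> powr m" and g = "\<lambda>x. max x 0 powr m"] bound) auto
  also have "\<dots> = ennreal (c_m m) * (\<integral>\<^sup>+x\<in>{..<1}. ennreal ((\<bar>x\<bar> + 1 - x) powr - (m + 1) - (3 - 2 * x) powr - (m + 1)) * ennreal (max x 0 powr m) \<partial>lborel)"
    by (rule scaled_occupation[OF m]) measurable
  also have "(\<integral>\<^sup>+x\<in>{..<1}. ennreal ((\<bar>x\<bar> + 1 - x) powr - (m + 1) - (3 - 2 * x) powr - (m + 1)) * ennreal (max x 0 powr m) \<partial>lborel)
    = (\<integral>\<^sup>+x\<in>{0<..<1}. ennreal (x powr m * (1 - (3 - 2 * x) powr - (m + 1))) \<partial>lborel)"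
    by (intro nn_integral_cong) (auto simp: ennreal_mult' max_def mult.commute split: split_indicator)
  also have "\<dots> = ennreal (phi m / 2 powr (m + 1))" by (rule positive_part_integral[OF m])
  finally show ?thesis using c by (simp add: ennreal_mult'[symmetric])
qed

lemma I_minus_eq:
  assumes m: "0 \<le> m"
  shows "I_minus M X m = ennreal (c_m m / 2 powr (m + 1) * ln 3)"
proof -
  have bound: "max (- x) 0 powr m \<le> \<bar>K\<bar> powr m" if "\<bar>x\<bar> \<le> K" for x K :: real
    using that m by (intro powr_mono2) auto
  have c: "0 \<le> c_m m" unfolding c_m_def using m by (intro divide_nonneg_nonneg mult_nonneg_nonneg Gamma_real_nonneg) auto
  have "I_minus M X m = (\<integral>\<^sup>+\<omega>\<in>{\<omega>. hits \<omega>}. ennreal (1 / \<tau> \<omega> powr (1 + m / 2)) * (\<integral>\<^sup>+s\<in>{0<..<\<tau> \<omega>}. ennreal (max (- X s \<omega>) 0 powr m) \<partial>lborel) \<partial>M)"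
    unfolding I_minus_def by (intro nn_integral_cong integrand_eq[where b = "\<lambda>K. \<bar>K\<bar> powr m" and g = "\<lambda>x. max (- x) 0 powr m"] bound) auto
  also have "\<dots> = ennreal (c_m m) * (\<integral>\<^sup>+x\<in>{..<1}. ennreal ((\<bar>x\<bar> + 1 - x) powr - (m + 1) - (3 - 2 * x) powr - (m + 1)) * ennreal (max (- x) 0 powr m) \<partial>lborel)"
    by (rule scaled_occupation[OF m]) measurable
  also have "(\<integral>\<^sup>+x\<in>{..<1}. ennreal ((\<bar>x\<bar> + 1 - x) powr - (m + 1) - (3 - 2 * x) powr - (m + 1)) * ennreal (max (- x) 0 powr m) \<partial>lborel)
    = (\<integral>\<^sup>+y\<in>{0<..}. ennreal (y powr m * ((1 + 2 * y) powr - (m + 1) - (3 + 2 * y) powr - (m + 1))) \<partial>lborel)"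
    by (subst nn_integral_real_affine[where c = "-1" and t = 0])
       (auto intro!: nn_integral_cong simp: ennreal_mult' max_def mult.commute split: split_indicator)
  also have "\<dots> = ennreal (ln 3 / 2 powr (m + 1))" by (rule negative_part_integral[OF m])
  finally show ?thesis using c by (simp add: ennreal_mult'[symmetric])
qed

end

lemma hitting_time_path_cong:
  assumes "\<forall>t\<ge>0. X t \<omega> = B t \<omega>"
  shows "hitting_time X a \<omega> = hitting_time B a \<omega>"
    and "(LBINT s=0..hitting_time X a \<omega>. g (X s \<omega>)) = (LBINT s=0..hitting_time B a \<omega>. (g (B s \<omega>) :: real))"
proof -
  have "{t. 0 \<le> t \<and> X t \<omega> = a} = {t. 0 \<le> t \<and> B t \<omega> = a}" using assms by auto
  then show eq: "hitting_time X a \<omega> = hitting_time B a \<omega>" by (simp add: hitting_time_def)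
  have "0 \<le> hitting_time B a \<omega>" unfolding hitting_time_def by (rule INF_greatest) (simp add: zero_ereal_def)
  then show "(LBINT s=0..hitting_time X a \<omega>. g (X s \<omega>)) = (LBINT s=0..hitting_time B a \<omega>. g (B s \<omega>))"
    unfolding eq using assms
    by (intro interval_integral_cong) (auto simp: einterval_iff zero_ereal_def min_def max_def split: if_splits)
qed

theorem theorem3p1:
  fixes M :: "'a measure" and B :: "real \<Rightarrow> 'a \<Rightarrow> real" and m :: real
  assumes "standard_brownian_motion M B" and "0 \<le> m"
  shows "I_plus M B m = ennreal (c_m m / 2 powr (m + 1) * phi m) \<and>
         I_minus M B m = ennreal (c_m m / 2 powr (m + 1) * ln 3)"
proof -
  interpret standard_brownian_motion M B by fact
  obtain X where X: "continuous_brownian_motion M X" and eq: "AE \<omega> in M. \<forall>t\<ge>0. X t \<omega> = B t \<omega>"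
    by (rule continuous_modification)
  interpret X: continuous_brownian_motion M X by fact
  have "I_plus M X m = I_plus M B m"
    unfolding I_plus_def
  proof (rule nn_integral_cong_AE, rule AE_mp[OF eq], rule AE_I2, rule impI)
    fix \<omega> assume "\<forall>t\<ge>0. X t \<omega> = B t \<omega>"
    note cong = hitting_time_path_cong[of X \<omega> B, OF this, of 1]
    show "ennreal (1 / real_of_ereal (hitting_time X 1 \<omega>) powr (1 + m / 2) * (LBINT s=0..hitting_time X 1 \<omega>. max (X s \<omega>) 0 powr m))
      = ennreal (1 / real_of_ereal (hitting_time B 1 \<omega>) powr (1 + m / 2) * (LBINT s=0..hitting_time B 1 \<omega>. max (B s \<omega>) 0 powr m))"
      by (simp only: cong(1) cong(2)[of "\<lambda>x. max x 0 powr m", unfolded cong(1)])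
  qed
  moreover have "I_minus M X m = I_minus M B m"
    unfolding I_minus_def
  proof (rule nn_integral_cong_AE, rule AE_mp[OF eq], rule AE_I2, rule impI)
    fix \<omega> assume "\<forall>t\<ge>0. X t \<omega> = B t \<omega>"
    note cong = hitting_time_path_cong[of X \<omega> B, OF this, of 1]
    show "ennreal (1 / real_of_ereal (hitting_time X 1 \<omega>) powr (1 + m / 2) * (LBINT s=0..hitting_time X 1 \<omega>. max (- X s \<omega>) 0 powr m))
      = ennreal (1 / real_of_ereal (hitting_time B 1 \<omega>) powr (1 + m / 2) * (LBINT s=0..hitting_time B 1 \<omega>. max (- B s \<omega>) 0 powr m))"
      by (simp only: cong(1) cong(2)[of "\<lambda>x. max (- x) 0 powr m", unfolded cong(1)])
  qed
  ultimately show ?thesis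
    using X.I_plus_eq[OF assms(2)] X.I_minus_eq[OF assms(2)] by simp
qed

end
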